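(* Let $k\ge 2$ and $n\ge k+3$. The $k$-cut complex $\Delta_k(P^2_n)$ of the squared path $P^2_n$ is shellable, and it is homotopy equivalent to a wedge of spheres of dimension $n-k-1$.
   Context: The squared path $P^2_n$ is the graph on vertex set $\{1,\dots,n\}$ with edges $\{i,i+1\}$ for $1\le i\le n-1$ and $\{i,i+2\}$ for $1\le i\le n-2$. For a graph $G=(V,E)$ with $|V|=n$ and $k\ge2$, the $k$-cut complex $\Delta_k(G)$ is the simplicial complex on $V$ whose facets are the subsets $F\subseteq V$ with $|F|=n-k$ such that the induced subgraph $G[V\setminus F]$ is disconnected. A simplicial complex is shellable if its facets admit an ordering $F_1,\dots,F_t$ such that for each $1<j\le t$, $\bigl(\bigcup_{i<j}\langle F_i\rangle\bigr)\cap\langle F_j\rangle$ is a complex all of whose facets have cardinality $|F_j|-1$, where $\langle F\rangle$ is the simplex on $F$. A wedge of zero spheres (a contractible space) is allowed. *)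

theory Defs
  imports "HOL-Analysis.Analysis" "Graph_Theory.Graph_Theory"
begin

section \<open>The squared path\<close>

text \<open>
  As usual in \<^theory>\<open>Graph_Theory.Graph_Theory\<close>, a simple graph is a symmetric loop-free digraph:
  the edge \<open>{u, v}\<close> is represented by the two arcs \<open>(u, v)\<close> and \<open>(v, u)\<close>.
\<close>

definition squared_path_arcs :: "nat \<Rightarrow> (nat \<times> nat) set" where
  "squared_path_arcs n =
     {(i, i + 1) | i. 1 \<le> i \<and> i + 1 \<le> n} \<union> {(i, i + 2) | i. 1 \<le> i \<and> i + 2 \<le> n}"

definition squared_path :: "nat \<Rightarrow> nat pair_pre_digraph" where
  "squared_path n =
     \<lparr> pverts = {1..n}, parcs = squared_path_arcs n \<union> (squared_path_arcs n)\<inverse> \<rparr>"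

lemma pair_graph_squared_path: "pair_graph (squared_path n)"
proof
  show "finite (parcs (squared_path n))"
    by (rule finite_subset[of _ "{1..n} \<times> {1..n}"])
       (auto simp: squared_path_def squared_path_arcs_def)
  show "symmetric (with_proj (squared_path n))"
    by (auto simp: symmetric_def sym_def squared_path_def)
qed (auto simp: squared_path_def squared_path_arcs_def)


section \<open>Abstract simplicial complexes and shellability\<close>

definition facets :: "'a set set \<Rightarrow> 'a set set" where
  "facets \<Delta> = {F \<in> \<Delta>. \<forall>G \<in> \<Delta>. F \<subseteq> G \<longrightarrow> G = F}"

text \<open>
  The simplex on \<open>F\<close> is \<^term>\<open>Pow F\<close>. Indices start at 0, so the condition concerns every facet of
  the list except the first one.
\<close>

definition shellable :: "'a set set \<Rightarrow> bool" where
  "shellable \<Delta> \<longleftrightarrow>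
     (\<exists>Fs. distinct Fs \<and> set Fs = facets \<Delta> \<and>
        (\<forall>j < length Fs. 0 < j \<longrightarrow>
           (\<forall>H \<in> facets ((\<Union>i<j. Pow (Fs ! i)) \<inter> Pow (Fs ! j)).
              Suc (card H) = card (Fs ! j))))"


section \<open>Cut complexes\<close>

definition cut_facets :: "nat \<Rightarrow> ('a, 'b) pre_digraph \<Rightarrow> 'a set set" where
  "cut_facets k G =
     {F. F \<subseteq> verts G \<and> card F + k = card (verts G) \<and>
         \<not> Digraph_Component.connected (G \<restriction> (verts G - F))}"

definition cut_complex :: "nat \<Rightarrow> ('a, 'b) pre_digraph \<Rightarrow> 'a set set" where
  "cut_complex k G = {\<sigma>. \<exists>F \<in> cut_facets k G. \<sigma> \<subseteq> F}"

lemma facets_cut_complex: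
  assumes "finite (verts G)"
  shows "facets (cut_complex k G) = cut_facets k G"
proof -
  have eq: "F = F'" if "F \<in> cut_facets k G" "F' \<in> cut_facets k G" "F \<subseteq> F'" for F F'
  proof (rule card_subset_eq)
    show "finite F'"
      using that(2) assms by (auto simp: cut_facets_def intro: finite_subset)
  qed (use that in \<open>auto simp: cut_facets_def\<close>)
  show ?thesis
  proof (intro equalityI subsetI)
    fix F assume "F \<in> facets (cut_complex k G)"
    then obtain F' where "F' \<in> cut_facets k G" "F \<subseteq> F'" "F' \<in> cut_complex k G \<Longrightarrow> F' = F"
      by (auto simp: facets_def cut_complex_def)
    then show "F \<in> cut_facets k G"
      by (auto simp: cut_complex_def)
  next
    fix F assume F: "F \<in> cut_facets k G"
    have "G' = F" if "G' \<in> cut_complex k G" "F \<subseteq> G'" for G'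
      using that eq[OF F] by (fastforce simp: cut_complex_def)
    with F show "F \<in> facets (cut_complex k G)"
      by (auto simp: facets_def cut_complex_def)
  qed
qed


section \<open>Geometric realization\<close>

text \<open>
  Points are given by barycentric coordinates. For a complex with finitely many vertices, as used
  here, the subspace topology of the product topology is the usual topology of the realization.
\<close>

definition geometric_realization :: "'a set set \<Rightarrow> ('a \<Rightarrow> real) topology" where
  "geometric_realization \<Delta> =
     subtopology (powertop_real UNIV)
       {x. (\<forall>v. 0 \<le> x v) \<and> {v. x v \<noteq> 0} \<in> \<Delta> \<and> (\<Sum>v | x v \<noteq> 0. x v) = 1}"


section \<open>Wedges of spheres\<close>

text \<open>
  The wedge of the pointed spaces \<open>(X i, p i)\<close> is the quotient of their disjoint union that
  identifies all base points. The common base point is \<^term>\<open>None\<close>, which is present also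
  for an empty index set, so that the empty wedge is a single point.
\<close>

definition wedge_proj :: "('i \<Rightarrow> 'a) \<Rightarrow> 'i \<times> 'a \<Rightarrow> ('i \<times> 'a) option" where
  "wedge_proj p = (\<lambda>(i, x). if x = p i then None else Some (i, x))"

definition wedge_topology ::
    "('i \<Rightarrow> 'a topology) \<Rightarrow> ('i \<Rightarrow> 'a) \<Rightarrow> 'i set \<Rightarrow> ('i \<times> 'a) option topology" where
  "wedge_topology X p I =
     topology (\<lambda>U. U \<subseteq> insert None (wedge_proj p ` topspace (sum_topology X I)) \<and>
       openin (sum_topology X I) {z \<in> topspace (sum_topology X I). wedge_proj p z \<in> U})"

lemma openin_wedge_topology:
  "openin (wedge_topology X p I) U \<longleftrightarrow>
     U \<subseteq> insert None (wedge_proj p ` topspace (sum_topology X I)) \<and>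
     openin (sum_topology X I) {z \<in> topspace (sum_topology X I). wedge_proj p z \<in> U}"
proof -
  let ?S = "sum_topology X I" and ?q = "wedge_proj p"
  have 1: "{z \<in> topspace ?S. ?q z \<in> U \<inter> V} =
      {z \<in> topspace ?S. ?q z \<in> U} \<inter> {z \<in> topspace ?S. ?q z \<in> V}" for U V
    by auto
  have 2: "{z \<in> topspace ?S. ?q z \<in> \<Union>K} = (\<Union>U\<in>K. {z \<in> topspace ?S. ?q z \<in> U})" for K
    by auto
  have "istopology (\<lambda>U. U \<subseteq> insert None (?q ` topspace ?S) \<and>
      openin ?S {z \<in> topspace ?S. ?q z \<in> U})"
    unfolding istopology_def 1 2 by blast
  then show ?thesis
    by (simp add: wedge_topology_def topology_inverse')
qed

lemma topspace_wedge_topology: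
  "topspace (wedge_topology X p I) = insert None (wedge_proj p ` topspace (sum_topology X I))"
proof (rule equalityI)
  let ?T = "insert None (wedge_proj p ` topspace (sum_topology X I))"
  have "{z \<in> topspace (sum_topology X I). wedge_proj p z \<in> ?T} = topspace (sum_topology X I)"
    by blast
  then have "openin (wedge_topology X p I) ?T"
    unfolding openin_wedge_topology by (metis openin_topspace subset_refl)
  then show "?T \<subseteq> topspace (wedge_topology X p I)"
    by (rule openin_subset)
  show "topspace (wedge_topology X p I) \<subseteq> ?T"
    using openin_topspace[of "wedge_topology X p I"] unfolding openin_wedge_topology by (rule conjunct1)
qed

lemma quotient_map_wedge_proj:
  assumes "I \<noteq> {}" and "\<And>i. i \<in> I \<Longrightarrow> p i \<in> topspace (X i)"
  shows "quotient_map (sum_topology X I) (wedge_topology X p I) (wedge_proj p)"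
proof -
  obtain i where i: "i \<in> I"
    using assms(1) by blast
  then have "(i, p i) \<in> topspace (sum_topology X I)"
    using assms(2) by auto
  moreover have "wedge_proj p (i, p i) = None"
    by (simp add: wedge_proj_def)
  ultimately have "None \<in> wedge_proj p ` topspace (sum_topology X I)"
    by (metis image_eqI)
  then have eq: "insert None (wedge_proj p ` topspace (sum_topology X I)) =
      wedge_proj p ` topspace (sum_topology X I)"
    by (rule insert_absorb)
  show ?thesis
    unfolding quotient_map_def topspace_wedge_topology openin_wedge_topology eq by blast
qed

text \<open>\<^term>\<open>nsphere d\<close> is the unit sphere of dimension \<open>d\<close>; its base point is \<open>(1, 0, \<dots>, 0)\<close>.\<close>

definition wedge_of_spheres ::
    "nat \<Rightarrow> nat \<Rightarrow> (nat \<times> (nat \<Rightarrow> real)) option topology" where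
  "wedge_of_spheres m d =
     wedge_topology (\<lambda>_. nsphere d) (\<lambda>_ i. if i = 0 then 1 else 0) {..<m}"

end

theory Submission
  imports Defs
begin

text \<open>
  A \<open>k\<close>-subset \<open>S\<close> of the vertices induces a disconnected subgraph iff it has two consecutive elements
  at distance at least 3. Order the facets by their complements \<open>S\<close>: first by \<open>Min S\<close>, then by
  reverse lexicographic order, a set coming later if it contains the first element in which the two
  sets differ. If \<open>A\<close> precedes \<open>B\<close>, one finds \<open>b \<in> A - B\<close> and \<open>a \<in> B\<close> such that \<open>B - {a} \<union> {b}\<close> still
  has a gap and precedes \<open>B\<close>; this is the shelling condition.

  For the homotopy type, run through any shelling of a pure complex. A new simplex is either attached
  along its whole boundary or along a proper nonempty set of its facets. Discarding the simplices
  of the first kind leaves a contractible subcomplex \<open>\<Gamma>\<close> that contains their boundaries. A contraction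
  of \<open>\<Gamma>\<close> extends radially over the discarded simplices, so the realization is equivalent to
  its quotient by \<open>\<Gamma>\<close>, and stereographic projection identifies this quotient with a wedge of spheres.
\<close>


section \<open>A shelling of the cut complex\<close>

text \<open>Swaps in complements move between neighbouring facets: if facets \<open>E\<close>,
  \<open>F\<close> have complements \<open>A\<close>, \<open>B\<close>, then
  \<open>b \<in> A - B\<close> is a vertex of \<open>F\<close> outside \<open>E\<close>, and the
  facet with complement \<open>B - {a} \<union> {b}\<close> meets \<open>F\<close> in
  \<open>F - {b}\<close>, which contains \<open>E \<inter> F\<close>. The obstacle is to keep a gap
  while moving back in the order, and it is why minima are compared first. In reverse lexicographic
  order alone {2, 3, 6} would precede {1, 4, 6}, but the gapped sets obtained from {1, 4, 6} by
  putting 2 or 3 in place of another element are {1, 2, 6} and {1, 3, 6}, which both come later.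
  With minima first, a smaller \<open>Min A\<close> is itself a good element to insert; for equal
  minima the first difference lies above the minimum, so when the left end of a gap is given up,
  \<open>B\<close> still has an element below it. In the topological half, the equal size of the
  facets ensures that discarded simplices meet each other only in \<Gamma>, so the contraction
  extends over each of them separately.\<close>

definition gapped :: "nat set \<Rightarrow> bool" where
  "gapped S \<longleftrightarrow> (\<exists>x\<in>S. \<exists>y\<in>S. x + 3 \<le> y \<and> (\<forall>z\<in>S. z \<le> x \<or> y \<le> z))"

lemma gappedI:
  "x \<in> S \<Longrightarrow> y \<in> S \<Longrightarrow> x + 3 \<le> y \<Longrightarrow> (\<And>z. z \<in> S \<Longrightarrow> z \<le> x \<or> y \<le> z) \<Longrightarrow> gapped S"
  by (auto simp: gapped_def)

section \<open>Connectedness of induced subgraphs\<close>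

text \<open>The library reads connectedness as reachability in the symmetric closure. Its arcs
  inside \<open>S\<close> are the pairs at distance 1 or 2, whichever vertices have been removed;
  this turns walks into arithmetic.\<close>

lemma reachable_induced_squared_path:
  assumes "S \<subseteq> {1..n}"
  shows "reachable (mk_symmetric (with_proj (squared_path n) \<restriction> S)) =
    (\<lambda>u v. (u, v) \<in> rtrancl_on S {(u, v). u \<in> S \<and> v \<in> S \<and> u \<noteq> v \<and> u \<le> v + 2 \<and> v \<le> u + 2})"
proof -
  let ?G = "mk_symmetric (with_proj (squared_path n) \<restriction> S)"
  have "arcs_ends (with_proj ?G) = {(u, v). u \<in> S \<and> v \<in> S \<and> u \<noteq> v \<and> u \<le> v + 2 \<and> v \<le> u + 2}"
    (is "_ = ?E")
  proof -
    have "(u, v) \<in> squared_path_arcs n \<longleftrightarrow> u < v \<and> v \<le> u + 2" if "u \<in> {1..n}" "v \<in> {1..n}" for u v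
    proof -
      have "v = u + 1 \<or> v = u + 2" if "u < v" "v \<le> u + 2"
        using that by arith
      then show ?thesis
        using that by (auto simp: squared_path_arcs_def)
    qed
    with assms have *: "u \<in> S \<Longrightarrow> v \<in> S \<Longrightarrow> (u, v) \<in> squared_path_arcs n \<longleftrightarrow> u < v \<and> v \<le> u + 2" for u v
      by blast
    have "arcs_ends (with_proj ?G) = parcs ?G"
      by (auto simp: arcs_ends_def arc_to_ends_def)
    also have "\<dots> = {(u, v). u \<in> S \<and> v \<in> S \<and> ((u, v) \<in> squared_path_arcs n \<or> (v, u) \<in> squared_path_arcs n)}"
      by (auto simp: mk_symmetric_def induce_subgraph_def squared_path_def)
    also have "\<dots> = ?E"
      using * by auto
    finally show ?thesis .
  qed
  then show ?thesis
    by (simp add: reachable_def fun_eq_iff mk_symmetric_def)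
qed

text \<open>An edge spans at most 2, so no walk crosses a gap. Without a gap the next larger element
  of \<open>S\<close> is always adjacent, and climbing along these successors reaches every larger
  vertex. The empty set is excluded because the library counts the empty graph as
  disconnected.\<close>

lemma connected_induced_squared_path_iff:
  assumes S: "S \<subseteq> {1..n}" and "S \<noteq> {}"
  shows "Digraph_Component.connected (with_proj (squared_path n) \<restriction> S) \<longleftrightarrow> \<not> gapped S"
proof -
  let ?E = "{(u, v). u \<in> S \<and> v \<in> S \<and> u \<noteq> v \<and> u \<le> v + 2 \<and> v \<le> u + 2}"
  have conn: "Digraph_Component.connected (with_proj (squared_path n) \<restriction> S) \<longleftrightarrow>
      (\<forall>u\<in>S. \<forall>v\<in>S. (u, v) \<in> rtrancl_on S ?E)"
    using \<open>S \<noteq> {}\<close> reachable_induced_squared_path[OF S]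
    by (simp add: connected_def strongly_connected_def mk_symmetric_def)
  show ?thesis
  proof
    assume L: "Digraph_Component.connected (with_proj (squared_path n) \<restriction> S)"
    show "\<not> gapped S"
    proof
      assume "gapped S"
      then obtain x y where xy: "x \<in> S" "y \<in> S" "x + 3 \<le> y" "\<And>z. z \<in> S \<Longrightarrow> z \<le> x \<or> y \<le> z"
        by (auto simp: gapped_def)
      \<comment> \<open>Leaving the part up to \<open>x\<close> would mean landing at
        \<open>y\<close> or beyond, at distance at least 3.\<close>
      have "v \<le> x" if "(x, v) \<in> rtrancl_on S ?E" for v
        using that
      proof (induction rule: rtrancl_on_induct)
        case (step v w)
        with xy(3) xy(4)[of w] show ?case by auto
      qed simp
      then have "y \<le> x"
        using L xy(1,2) unfolding conn by blast
      with xy(3) show False by simp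
    qed
  next
    assume R: "\<not> gapped S"
    have up: "(u, v) \<in> rtrancl_on S ?E" if "u \<in> S" "v \<in> S" "u \<le> v" for u v
      using that
    proof (induction "v - u" arbitrary: u rule: less_induct)
      case less
      show ?case
      proof (cases "u = v")
        case False
        define w where "w = (LEAST w. w \<in> S \<and> u < w)"
        have w: "w \<in> S" "u < w" "\<And>z. z \<in> S \<Longrightarrow> u < z \<Longrightarrow> w \<le> z"
          using LeastI[of "\<lambda>w. w \<in> S \<and> u < w" v] less False Least_le[of "\<lambda>w. w \<in> S \<and> u < w"]
          unfolding w_def by auto
        have "w \<le> u + 2"
        proof (rule ccontr)
          assume "\<not> w \<le> u + 2"
          then have "gapped S"
            using less w by (intro gappedI[of u S w]) (auto simp: not_le[symmetric])
          with R show False by blast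
        qed
        with w less have "(u, w) \<in> ?E" by auto
        moreover have "(w, v) \<in> rtrancl_on S ?E"
          using less.prems w False by (intro less.hyps) auto
        ultimately show ?thesis
          using less.prems(1) by (rule converse_rtrancl_on_into_rtrancl_on)
      qed (use less in auto)
    qed
    have sym: "?E\<inverse> = ?E" by auto
    have "(u, v) \<in> rtrancl_on S ?E" if "u \<in> S" "v \<in> S" for u v
    proof (cases "u \<le> v")
      case False
      then have "(v, u) \<in> rtrancl_on S ?E" using up that by simp
      then have "(u, v) \<in> rtrancl_on S (?E\<inverse>)" by (rule rtrancl_on_converseI)
      then show ?thesis unfolding sym .
    qed (use up that in auto)
    then show "Digraph_Component.connected (with_proj (squared_path n) \<restriction> S)"
      unfolding conn by blast
  qed
qed

section \<open>The shelling order\<close>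

definition set_code :: "nat \<Rightarrow> nat set \<Rightarrow> nat" where
  "set_code n S = (\<Sum>i\<in>S. 2 ^ (n - i))"

text \<open>
  The code realizes the reverse lexicographic order; it is less than \<open>2 ^ Suc n\<close>, so that in
  the key the minimum takes precedence.
\<close>

definition shelling_key :: "nat \<Rightarrow> nat set \<Rightarrow> nat" where
  "shelling_key n S = Min S * 2 ^ Suc n + set_code n S"

text \<open>Up to \<open>n\<close> truncated subtraction is injective, so the code is a sum of
  distinct powers of two with exponents below \<open>k\<close>.\<close>

lemma set_code_bound:
  assumes "A \<subseteq> {..n}" and "\<And>i. i \<in> A \<Longrightarrow> n - i < k"
  shows "set_code n A < 2 ^ k"
proof -
  have "inj_on (\<lambda>i. n - i) A"
    using assms(1) by (auto simp: inj_on_def subset_iff) (metis diff_diff_cancel)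
  then have "set_code n A = (\<Sum>j\<in>(\<lambda>i. n - i) ` A. 2 ^ j)"
    by (simp add: set_code_def sum.reindex)
  also have "\<dots> \<le> (\<Sum>j<k. 2 ^ j)"
    using assms(2) by (intro sum_mono2) auto
  also have "\<dots> < (2::nat) ^ k"
    by (induction k) auto
  finally show ?thesis .
qed

text \<open>Comparison of binary numbers: the digits before \<open>m\<close> agree, and the digit of
  \<open>m\<close> outweighs all later ones together.\<close>

lemma set_code_less:
  assumes "A \<subseteq> {..n}" "B \<subseteq> {..n}" "m \<in> B" "m \<notin> A" "\<And>i. i < m \<Longrightarrow> i \<in> A \<longleftrightarrow> i \<in> B"
  shows "set_code n A < set_code n B"
proof -
  have fin: "finite A" "finite B"
    using assms(1,2) finite_subset by blast+
  have split: "set_code n C = set_code n (C \<inter> {..<m}) + set_code n (C \<inter> {m..})" if "finite C" for C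
    using that unfolding set_code_def
    by (subst sum.union_disjoint[symmetric]) (auto intro!: sum.cong)
  have "A \<inter> {..<m} = B \<inter> {..<m}"
    using assms(5) by auto
  moreover have "set_code n (A \<inter> {m..}) < 2 ^ (n - m)"
  proof (rule set_code_bound)
    fix i assume "i \<in> A \<inter> {m..}"
    with assms(1,4) have "m < i" "i \<le> n" by (auto simp: order.order_iff_strict)
    then show "n - i < n - m" by simp
  qed (use assms(1) in auto)
  moreover have "2 ^ (n - m) \<le> set_code n (B \<inter> {m..})"
    unfolding set_code_def using assms(3) fin by (intro member_le_sum) auto
  ultimately show ?thesis
    using split[OF fin(1)] split[OF fin(2)] by simp
qed

lemma set_code_swap_less:
  assumes "finite B" "a \<in> B" "b \<notin> B" "a < b" "b \<le> n"
  shows "set_code n (insert b (B - {a})) < set_code n B"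
proof -
  have "set_code n (insert b (B - {a})) = 2 ^ (n - b) + set_code n (B - {a})"
    using assms by (simp add: set_code_def)
  moreover have "set_code n B = 2 ^ (n - a) + set_code n (B - {a})"
    using assms by (simp add: set_code_def sum.remove)
  moreover have "(2::nat) ^ (n - b) < 2 ^ (n - a)"
    using assms by (intro power_strict_increasing) auto
  ultimately show ?thesis by simp
qed

lemma shelling_key_less_iff:
  assumes "A \<subseteq> {..n}" "B \<subseteq> {..n}"
  shows "shelling_key n A < shelling_key n B \<longleftrightarrow>
    Min A < Min B \<or> Min A = Min B \<and> set_code n A < set_code n B"
proof -
  have bound: "set_code n C < 2 ^ Suc n" if "C \<subseteq> {..n}" for C
    using that by (intro set_code_bound) auto
  have less: "shelling_key n C < shelling_key n D" if "C \<subseteq> {..n}" "Min C < Min D" for C D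
  proof -
    have "shelling_key n C < Suc (Min C) * 2 ^ Suc n"
      using bound[OF that(1)] by (simp add: shelling_key_def)
    also have "\<dots> \<le> Min D * 2 ^ Suc n"
      using that(2) by (intro mult_right_mono) auto
    also have "\<dots> \<le> shelling_key n D"
      by (simp add: shelling_key_def)
    finally show ?thesis .
  qed
  show ?thesis
    using less[of A B] less[of B A] assms
    by (cases "Min A" "Min B" rule: linorder_cases) (auto simp: shelling_key_def)
qed

lemma set_eq_or_differ_first:
  fixes A B :: "nat set"
  assumes "A \<noteq> B"
  obtains m where "m \<in> (A - B) \<union> (B - A)" "\<And>i. i < m \<Longrightarrow> i \<in> A \<longleftrightarrow> i \<in> B"
proof -
  have "\<exists>m. m \<in> (A - B) \<union> (B - A)"
    using assms by blast
  then have "(LEAST m. m \<in> (A - B) \<union> (B - A)) \<in> (A - B) \<union> (B - A)"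
    by (rule LeastI_ex)
  moreover have "i \<in> A \<longleftrightarrow> i \<in> B" if "i < (LEAST m. m \<in> (A - B) \<union> (B - A))" for i
    using not_less_Least[OF that] by blast
  ultimately show ?thesis
    by (rule that)
qed

lemma inj_on_shelling_key: "inj_on (shelling_key n) (Pow {..n})"
proof (rule inj_onI, rule ccontr)
  fix A B assume AB: "A \<in> Pow {..n}" "B \<in> Pow {..n}" "shelling_key n A = shelling_key n B" "A \<noteq> B"
  then obtain m where m: "m \<in> (A - B) \<union> (B - A)" "\<And>i. i < m \<Longrightarrow> i \<in> A \<longleftrightarrow> i \<in> B"
    using set_eq_or_differ_first by metis
  have "\<not> shelling_key n A < shelling_key n B" "\<not> shelling_key n B < shelling_key n A"
    using AB(3) by auto
  then have "set_code n A = set_code n B"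
    using AB(1,2) shelling_key_less_iff[of A n B] shelling_key_less_iff[of B n A]
    by (metis PowD linorder_neqE_nat)
  moreover have "set_code n A < set_code n B" if "m \<in> B - A"
    using that m AB by (intro set_code_less) auto
  moreover have "set_code n B < set_code n A" if "m \<in> A - B"
    using that m AB by (intro set_code_less) auto
  ultimately show False
    using m(1) by auto
qed

text \<open>
  Let \<open>(x, y)\<close> be a gap of \<open>B\<close>. An element \<open>b \<in> A - B\<close> outside the gap can be exchanged for \<open>y\<close> or for
  the first element \<open>m\<close> where the sets differ. If all of \<open>A - B\<close> lies in the gap, an element \<open>b \<ge> x + 2\<close>
  can replace \<open>x\<close>, which leaves a gap ending in \<open>b\<close>; otherwise \<open>A - B = {x + 1}\<close>, and exchanging
  \<open>m\<close> for \<open>x + 1\<close> gives \<open>A\<close> itself.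
\<close>

lemma gapped_exchange:
  assumes A: "A \<subseteq> {..n}" and B: "B \<subseteq> {..n}" and card: "card A = card B"
    and gA: "gapped A" and gB: "gapped B" and key: "shelling_key n A < shelling_key n B"
  obtains a b where "a \<in> B" "b \<in> A - B" "gapped (insert b (B - {a}))"
    "shelling_key n (insert b (B - {a})) < shelling_key n B"
proof -
  note exchange = that
  have fin: "finite A" "finite B"
    using A B finite_subset by blast+
  have ne: "A \<noteq> {}" "B \<noteq> {}"
    using gA gB by (auto simp: gapped_def)
  obtain x y where xy: "x \<in> B" "y \<in> B" "x + 3 \<le> y" "\<And>z. z \<in> B \<Longrightarrow> z \<le> x \<or> y \<le> z"
    using gB by (auto simp: gapped_def)
  have ins: "insert b (B - {a}) \<subseteq> {..n}" if "b \<in> A" for a b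
    using that A B by auto
  have prev: "\<exists>x'\<in>C. x' < x \<and> (\<forall>z\<in>C. z < x \<longrightarrow> z \<le> x')" if "finite C" "z \<in> C" "z < x" for C and z :: nat
  proof (intro bexI conjI ballI impI)
    show "Max {z \<in> C. z < x} \<in> C" "Max {z \<in> C. z < x} < x"
      using Max_in[of "{z \<in> C. z < x}"] that by fastforce+
  qed (use that in auto)
  consider "Min A < Min B" | "Min A = Min B" "set_code n A < set_code n B"
    using key A B by (auto simp: shelling_key_less_iff)
  then show thesis
  proof cases
    \<comment> \<open>\<open>Min A\<close> lies below all of \<open>B\<close>, so inserting it
      lowers the minimum, which settles the order. Removing \<open>x\<close> widens the gap to the
      left: its new left end is the predecessor of \<open>x\<close>, at worst \<open>b\<close>
      itself.\<close>
    case 1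
    define b where "b = Min A"
    let ?C = "insert b (B - {x})"
    have b: "b \<in> A" "\<And>z. z \<in> B \<Longrightarrow> b < z"
      using 1 fin ne by (auto simp: b_def)
    have "Min ?C = b"
      using fin b(2) by (intro Min_eqI) (auto dest: b(2))
    then have "shelling_key n ?C < shelling_key n B"
      using 1 ins[OF b(1)] B by (subst shelling_key_less_iff) (auto simp: b_def)
    moreover have "gapped ?C"
    proof -
      obtain x' where x': "x' \<in> ?C" "x' < x" "\<And>z. z \<in> ?C \<Longrightarrow> z < x \<Longrightarrow> z \<le> x'"
        using prev[of ?C b] fin b(2)[OF xy(1)] by auto
      show ?thesis
      proof (rule gappedI[of x' ?C y])
        fix z assume z: "z \<in> ?C"
        then have "z < x \<or> y \<le> z"
          using b(2)[OF xy(1)] xy(4)[of z] by auto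
        with x'(3)[OF z] show "z \<le> x' \<or> y \<le> z" by blast
      qed (use xy x' in auto)
    qed
    ultimately show thesis
      using that xy(1) b by blast
  next
    case 2
    then have "A \<noteq> B" by auto
    then obtain m where m: "m \<in> (A - B) \<union> (B - A)" "\<And>i. i < m \<Longrightarrow> i \<in> A \<longleftrightarrow> i \<in> B"
      using set_eq_or_differ_first by metis
    have "m \<notin> A - B"
      using set_code_less[of B n A m] A B m 2 by force
    with m have mB: "m \<in> B" "m \<notin> A" by auto
    \<comment> \<open>The common minimum belongs to both sets, so the first difference lies strictly
      above it.\<close>
    have mMin: "Min B < m"
      using mB fin ne Min_in[OF fin(1) ne(1)] 2 Min_le[OF fin(2) mB(1)] by (metis le_neq_implies_less)
    have mb: "m < b" if "b \<in> A - B" for b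
      using m that mB by (metis DiffE linorder_neqE_nat)
    \<comment> \<open>As long as \<open>Min B\<close> stays in place, only the codes are compared,
      and moving an element upwards lowers the code.\<close>
    have swap: thesis if "b \<in> A - B" "a \<in> B" "a < b" "a \<noteq> Min B" "gapped (insert b (B - {a}))" for a b
    proof -
      let ?C = "insert b (B - {a})"
      have "Min B < b" using mMin mb that by force
      then have "Min ?C = Min B"
        using fin ne that by (intro Min_eqI) auto
      moreover have "set_code n ?C < set_code n B"
        using that fin A by (intro set_code_swap_less) auto
      ultimately have "shelling_key n ?C < shelling_key n B"
        using ins[of b a] that B by (subst shelling_key_less_iff) auto
      then show thesis
        using that by (intro exchange[of a b])
    qed
    show thesis
    proof (cases "\<exists>b\<in>A - B. b < x \<or> y < b")
      case True
      then obtain b where b: "b \<in> A - B" "b < x \<or> y < b" by blast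
      show thesis
      proof (cases "y < b")
        case True
        have "gapped (insert b (B - {y}))" (is "gapped ?C")
        proof -
          \<comment> \<open>Once \<open>y\<close> is gone, the gap extends to the next larger
            element; \<open>b\<close> guarantees that there is one.\<close>
          have ex: "\<exists>z. z \<in> ?C \<and> y < z" using True by auto
          define z where "z = (LEAST z. z \<in> ?C \<and> y < z)"
          have z: "z \<in> ?C" "y < z" "\<And>w. w \<in> ?C \<Longrightarrow> y < w \<Longrightarrow> z \<le> w"
            using LeastI_ex[OF ex] Least_le[of "\<lambda>z. z \<in> ?C \<and> y < z"] unfolding z_def by auto
          show ?thesis
          proof (rule gappedI[of x ?C z])
            fix w assume w: "w \<in> ?C"
            then show "w \<le> x \<or> z \<le> w"
              using z(3)[of w] xy(4)[of w] True by (cases "y < w") auto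
          qed (use xy z b in auto)
        qed
        moreover have "y \<noteq> Min B" using xy(3) Min_le[OF fin(2) xy(1)] by linarith
        ultimately show thesis
          using swap[of b y] b True xy by blast
      next
        case False
        then have "b < x" using b by simp
        with mb[OF b(1)] have "gapped (insert b (B - {m}))"
          using xy by (intro gappedI[of x _ y]) (auto dest: xy(4))
        then show thesis
          using swap[of b m] b mb mB mMin by blast
      qed
    next
      case False
      then have within: "x < b \<and> b < y" if "b \<in> A - B" for b
        using that xy(1,2) by (metis DiffE linorder_neqE_nat)
      have "A - B \<noteq> {}"
        using \<open>A \<noteq> B\<close> card fin by (metis Diff_eq_empty_iff card_subset_eq)
      \<comment> \<open>\<open>m\<close> is an element of \<open>B\<close> below some element of the
        gap, hence not above its left end.\<close>
      have mx: "m \<le> x"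
        using \<open>A - B \<noteq> {}\<close> mb within xy(4)[OF mB(1)] by force
      have Minx: "Min B < x" using mx mMin by simp
      obtain x' where x': "x' \<in> B" "x' < x" "\<And>z. z \<in> B \<Longrightarrow> z < x \<Longrightarrow> z \<le> x'"
        using prev[of B "Min B"] fin ne Minx Min_in by blast
      show thesis
      proof (cases "\<exists>b\<in>A - B. x + 2 \<le> b")
        case True
        then obtain b where b: "b \<in> A - B" "x + 2 \<le> b" by blast
        have "gapped (insert b (B - {x}))" (is "gapped ?C")
        proof (rule gappedI[of x' ?C b])
          fix z assume "z \<in> ?C"
          then have "z < x \<and> z \<in> B \<or> b \<le> z"
            using within[OF b(1)] xy(4)[of z] by auto
          with x'(3)[of z] show "z \<le> x' \<or> b \<le> z" by blast
        qed (use x' b in auto)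
        then show thesis
          using swap[of b x] b xy Minx by auto
      next
        case False
        have "b = x + 1" if "b \<in> A - B" for b
        proof -
          have "\<not> x + 2 \<le> b" using that False by blast
          then show ?thesis using within[OF that] by linarith
        qed
        with \<open>A - B \<noteq> {}\<close> have AB: "A - B = {x + 1}" by blast
        have "card (B - A) = card (A - B)"
          using card fin by (metis card_Diff_subset_Int Int_commute finite_Int)
        then have "card (B - A) = 1" using AB by simp
        then have "B - A = {m}" using mB by (metis DiffI card_1_singletonE singletonD)
        with AB have "A = insert (x + 1) (B - {m})" by blast
        then show thesis
          using swap[of "x + 1" m] AB gA mx mB mMin by auto
      qed
    qed
  qed
qed

section \<open>From exchanges to a shelling\<close>

text \<open>A maximal face \<open>H\<close> of the intersection with the earlier facets lies in some
  \<open>E \<inter> F\<close>. The exchange places it inside \<open>F - {v}\<close>, which is again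
  contained in an earlier facet, so maximality forces \<open>H = F - {v}\<close>.\<close>

lemma shellable_if_exchange:
  fixes key :: "'a set \<Rightarrow> nat"
  assumes fin: "finite (facets \<Delta>)" and inj: "inj_on key (facets \<Delta>)"
    and finF: "\<And>F. F \<in> facets \<Delta> \<Longrightarrow> finite F"
    and exch: "\<And>E F. \<lbrakk>E \<in> facets \<Delta>; F \<in> facets \<Delta>; key E < key F\<rbrakk> \<Longrightarrow>
      \<exists>G\<in>facets \<Delta>. \<exists>v\<in>F. key G < key F \<and> E \<inter> F \<subseteq> G \<inter> F \<and> G \<inter> F = F - {v}"
  shows "shellable \<Delta>"
proof -
  define Fs where "Fs = map (inv_into (facets \<Delta>) key) (sorted_list_of_set (key ` facets \<Delta>))"
  have "map key Fs = sorted_list_of_set (key ` facets \<Delta>)"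
    unfolding Fs_def map_map by (rule map_idI) (use fin in \<open>auto simp: f_inv_into_f\<close>)
  then have Fs: "distinct Fs" "sorted_wrt (<) (map key Fs)"
    using fin by (metis distinct_map sorted_list_of_set.distinct_sorted_key_list_of_set, simp)
  have "set Fs = facets \<Delta>"
    using fin inj by (simp add: Fs_def image_image)
  note Fs = Fs(1) this Fs(2)
  show ?thesis
    unfolding shellable_def
  proof (intro exI[of _ Fs] conjI allI impI ballI Fs(1,2))
    fix j H
    assume j: "j < length Fs" and H: "H \<in> facets ((\<Union>i<j. Pow (Fs ! i)) \<inter> Pow (Fs ! j))"
    let ?F = "Fs ! j"
    have F: "?F \<in> facets \<Delta>" using j Fs(2) nth_mem by blast
    obtain i where i: "i < j" "H \<subseteq> Fs ! i" "H \<subseteq> ?F"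
      using H by (auto simp: facets_def)
    have "key (Fs ! i) < key ?F"
      using Fs(3) i(1) j by (simp add: sorted_wrt_iff_nth_less)
    moreover have "Fs ! i \<in> facets \<Delta>"
      using i(1) j Fs(2) nth_mem[of i Fs] by auto
    ultimately obtain G v where G: "G \<in> facets \<Delta>" "v \<in> ?F" "key G < key ?F"
        "Fs ! i \<inter> ?F \<subseteq> G \<inter> ?F" "G \<inter> ?F = ?F - {v}"
      using exch[of "Fs ! i" ?F] F by auto
    obtain l where l: "l < length Fs" "Fs ! l = G"
      using G(1) Fs(2) by (metis in_set_conv_nth)
    have "l < j"
    proof (rule ccontr)
      assume "\<not> l < j"
      then have "key ?F \<le> key (Fs ! l)"
        using Fs(3) l(1) j by (cases "l = j") (auto simp: sorted_wrt_iff_nth_less intro: less_imp_le)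
      with l G show False by simp
    qed
    then have "G \<inter> ?F \<in> (\<Union>i<j. Pow (Fs ! i)) \<inter> Pow ?F"
      using l by auto
    moreover have "H \<subseteq> G \<inter> ?F" using i G by auto
    ultimately have "G \<inter> ?F = H"
      using H by (auto simp: facets_def)
    with G(5) have "H = ?F - {v}" by simp
    then show "Suc (card H) = card ?F"
      using card_Suc_Diff1[OF finF[OF F] G(2)] by simp
  qed
qed

lemma cut_facets_squared_path:
  assumes "1 \<le> k"
  shows "cut_facets k (with_proj (squared_path n)) =
    {F. F \<subseteq> {1..n} \<and> card F + k = n \<and> gapped ({1..n} - F)}"
proof -
  have "{1..n} - F \<noteq> {}" if "F \<subseteq> {1..n}" "card F + k = n" for F
  proof
    assume "{1..n} - F = {}"
    with that(1) have "F = {1..n}" by blast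
    with that(2) assms show False by simp
  qed
  then show ?thesis
    using connected_induced_squared_path_iff[of "{1..n} - _" n]
    by (auto simp: cut_facets_def squared_path_def)
qed

lemma shellable_cut_complex_squared_path:
  assumes "1 \<le> k"
  shows "shellable (cut_complex k (with_proj (squared_path n)))"
proof (rule shellable_if_exchange)
  let ?\<Delta> = "cut_complex k (with_proj (squared_path n))"
  have facets: "facets ?\<Delta> = {F. F \<subseteq> {1..n} \<and> card F + k = n \<and> gapped ({1..n} - F)}"
    using facets_cut_complex[of "with_proj (squared_path n)" k] cut_facets_squared_path[OF assms]
    by (simp add: squared_path_def)
  show "finite (facets ?\<Delta>)"
    unfolding facets by (rule finite_subset[of _ "Pow {1..n}"]) auto
  show "finite F" if "F \<in> facets ?\<Delta>" for F
    using that unfolding facets by (auto intro: finite_subset)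
  let ?key = "\<lambda>F. shelling_key n ({1..n} - F)"
  show "inj_on ?key (facets ?\<Delta>)"
  proof (rule inj_onI)
    fix E F assume EF: "E \<in> facets ?\<Delta>" "F \<in> facets ?\<Delta>" "?key E = ?key F"
    have "{1..n} - E = {1..n} - F"
      using inj_on_shelling_key[of n] EF(3) by (rule inj_onD) auto
    then show "E = F"
      using EF(1,2) unfolding facets by auto
  qed
  fix E F assume E: "E \<in> facets ?\<Delta>" and F: "F \<in> facets ?\<Delta>" and key: "?key E < ?key F"
  have "card ({1..n} - C) = k" if "C \<in> facets ?\<Delta>" for C
  proof -
    have "C \<subseteq> {1..n}" "card C + k = n" using that unfolding facets by auto
    then show ?thesis by (simp add: card_Diff_subset finite_subset)
  qed
  with E F have "card ({1..n} - E) = card ({1..n} - F)" by simp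
  moreover have sub: "{1..n} - C \<subseteq> {..n}" for C by auto
  ultimately obtain a b where ab: "a \<in> {1..n} - F" "b \<in> ({1..n} - E) - ({1..n} - F)"
    "gapped (insert b (({1..n} - F) - {a}))" "shelling_key n (insert b (({1..n} - F) - {a})) < ?key F"
    using gapped_exchange[of "{1..n} - E" n "{1..n} - F"] E F key unfolding facets by (metis (no_types, lifting) mem_Collect_eq sub)
  let ?G = "insert a (F - {b})"
  have bF: "b \<in> F" "b \<notin> E" "b \<in> {1..n}" using ab by auto
  have eq: "{1..n} - ?G = insert b (({1..n} - F) - {a})"
    using ab F unfolding facets by auto
  have "finite F" using F unfolding facets by (auto intro: finite_subset)
  then have "card ?G = card F"
    using ab(1) card_Suc_Diff1[OF _ bF(1)] by simp
  with F ab eq have "?G \<in> facets ?\<Delta>"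
    unfolding facets by auto
  then show "\<exists>G\<in>facets ?\<Delta>. \<exists>v\<in>F. ?key G < ?key F \<and> E \<inter> F \<subseteq> G \<inter> F \<and> G \<inter> F = F - {v}"
    using ab bF eq by (intro bexI[of _ ?G] bexI[of _ b]) auto
qed

lemma cut_complex_squared_path_nonempty:
  assumes "2 \<le> k" "k + 2 \<le> n"
  shows "cut_complex k (with_proj (squared_path n)) \<noteq> {}"
proof -
  \<comment> \<open>\<open>k - 1\<close> and \<open>k + 2\<close> bound a gap of the least possible
    width; \<open>2 \<le> k\<close> makes \<open>k - 1\<close> an element of the interval.\<close>
  let ?S = "insert (k + 2) {1..k - 1}"
  have "gapped ?S"
    using assms by (intro gappedI[of "k - 1" ?S "k + 2"]) auto
  moreover have S: "?S \<subseteq> {1..n}" "card ?S = k"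
    using assms by auto
  moreover from S have "card ({1..n} - ?S) + k = n"
    using assms by (subst card_Diff_subset) auto
  moreover from S have "{1..n} - ({1..n} - ?S) = ?S" by blast
  ultimately have "{1..n} - ?S \<in> cut_facets k (with_proj (squared_path n))"
    using assms by (subst cut_facets_squared_path) auto
  then show ?thesis
    unfolding cut_complex_def by blast
qed


section \<open>Realizations of finite complexes\<close>

definition realization :: "'a set set \<Rightarrow> ('a \<Rightarrow> real) set" where
  "realization \<Delta> = {x. (\<forall>v. 0 \<le> x v) \<and> {v. x v \<noteq> 0} \<in> \<Delta> \<and> (\<Sum>v | x v \<noteq> 0. x v) = 1}"

definition finite_complex :: "'a set set \<Rightarrow> bool" where
  "finite_complex \<Delta> \<longleftrightarrow> finite (\<Union>\<Delta>) \<and> (\<forall>\<sigma>\<in>\<Delta>. Pow \<sigma> \<subseteq> \<Delta>)"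

lemma geometric_realization_eq: "geometric_realization \<Delta> = top_of_set (realization \<Delta>)"
  by (simp add: geometric_realization_def realization_def euclidean_product_topology)

lemma realization_mono: "\<Delta> \<subseteq> \<Gamma> \<Longrightarrow> realization \<Delta> \<subseteq> realization \<Gamma>"
  by (auto simp: realization_def)

lemma realization_Un: "realization (\<Delta> \<union> \<Gamma>) = realization \<Delta> \<union> realization \<Gamma>"
  by (auto simp: realization_def)

lemma realization_UN: "realization (\<Union>i\<in>I. \<Delta> i) = (\<Union>i\<in>I. realization (\<Delta> i))"
  by (auto simp: realization_def)

text \<open>The sum over the support, which varies with the point, becomes a sum over the fixed
  finite set \<open>F\<close>. This makes the conditions visibly closed.\<close>

lemma realization_Pow:
  assumes "finite F"
  shows "realization (Pow F) = {x. (\<forall>v. 0 \<le> x v) \<and> (\<forall>v. v \<notin> F \<longrightarrow> x v = 0) \<and> sum x F = 1}"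
proof -
  have "(\<Sum>v | x v \<noteq> 0. x v) = sum x F" if "{v. x v \<noteq> 0} \<subseteq> F" for x :: "'a \<Rightarrow> real"
    using that assms by (intro sum.mono_neutral_left) auto
  moreover have "{v. x v \<noteq> 0} \<subseteq> F \<longleftrightarrow> (\<forall>v. v \<notin> F \<longrightarrow> x v = 0)" for x :: "'a \<Rightarrow> real"
    by auto
  ultimately show ?thesis
    unfolding realization_def Pow_iff by (intro Collect_cong) metis
qed

lemma realization_Pow_face:
  assumes "x \<in> realization (Pow F)" "{v. x v \<noteq> 0} \<in> \<Delta>"
  shows "x \<in> realization \<Delta>"
  using assms by (simp add: realization_def)

lemma finite_complexD:
  assumes "finite_complex \<Delta>"
  shows "finite \<Delta>" "\<And>\<sigma>. \<sigma> \<in> \<Delta> \<Longrightarrow> finite \<sigma>" "\<And>\<sigma> \<tau>. \<sigma> \<in> \<Delta> \<Longrightarrow> \<tau> \<subseteq> \<sigma> \<Longrightarrow> \<tau> \<in> \<Delta>"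
proof -
  show "finite \<Delta>"
    using assms by (auto simp: finite_complex_def intro: finite_UnionD)
  show "\<And>\<sigma>. \<sigma> \<in> \<Delta> \<Longrightarrow> finite \<sigma>"
    using assms by (auto simp: finite_complex_def intro: finite_subset)
  show "\<And>\<sigma> \<tau>. \<sigma> \<in> \<Delta> \<Longrightarrow> \<tau> \<subseteq> \<sigma> \<Longrightarrow> \<tau> \<in> \<Delta>"
    using assms by (auto simp: finite_complex_def)
qed

lemma finite_complex_Pow: "finite F \<Longrightarrow> finite_complex (Pow F)"
  by (auto simp: finite_complex_def)

lemma finite_complex_Un: "finite_complex \<Delta> \<Longrightarrow> finite_complex \<Gamma> \<Longrightarrow> finite_complex (\<Delta> \<union> \<Gamma>)"
  unfolding finite_complex_def by auto

lemma continuous_on_snd_apply [continuous_intros]: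
  "continuous_on S (\<lambda>z :: 'a::topological_space \<times> ('b \<Rightarrow> 'c::topological_space). snd z v)"
  by (rule continuous_on_product_then_coordinatewise) (intro continuous_intros)

lemma continuous_on_Min_image [continuous_intros]:
  fixes f :: "'a::topological_space \<Rightarrow> 'b \<Rightarrow> real"
  assumes "finite R" "R \<noteq> {}" "\<And>v. v \<in> R \<Longrightarrow> continuous_on S (\<lambda>x. f x v)"
  shows "continuous_on S (\<lambda>x. Min (f x ` R))"
  using assms
proof (induction R rule: finite_ne_induct)
  case (insert v R)
  have "(\<lambda>x. Min (f x ` insert v R)) = (\<lambda>x. min (f x v) (Min (f x ` R)))"
    using insert.hyps by simp
  then show ?case
    using insert by (auto intro!: continuous_on_min)
qed simp

lemma closed_realization_Pow:
  assumes "finite F"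
  shows "closed (realization (Pow F))"
proof -
  have "closed {x :: 'a \<Rightarrow> real. 0 \<le> x v}" for v
    by (intro closed_Collect_le continuous_on_const continuous_on_product_coordinates)
  moreover have "closed {x :: 'a \<Rightarrow> real. v \<notin> F \<longrightarrow> x v = 0}" for v
    by (cases "v \<in> F") (simp_all add: closed_Collect_eq)
  moreover have "closed {x :: 'a \<Rightarrow> real. sum x F = 1}"
    by (intro closed_Collect_eq continuous_intros continuous_on_product_coordinates)
  ultimately show ?thesis
    unfolding realization_Pow[OF assms]
    by (intro closed_Collect_conj closed_Collect_all) auto
qed

text \<open>A closed subset of a cube, which is compact by Tychonoff.\<close>

lemma compact_realization_Pow:
  assumes "finite F"
  shows "compact (realization (Pow F))"
proof -
  note closed_realization_Pow[OF assms]
  moreover have "compact (PiE UNIV (\<lambda>_. {0..1}) :: ('a \<Rightarrow> real) set)"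
  proof -
    have "compactin (powertop_real UNIV) (PiE UNIV (\<lambda>_. {0..1}) :: ('a \<Rightarrow> real) set)"
      by (simp add: compactin_PiE)
    then show ?thesis by (simp add: euclidean_product_topology)
  qed
  moreover have "x \<in> PiE UNIV (\<lambda>_. {0..1})" if "x \<in> realization (Pow F)" for x
  proof -
    have "x v \<le> 1" for v
    proof (cases "v \<in> F")
      case True
      then have "x v \<le> sum x F"
        using that assms by (intro member_le_sum) (auto simp: realization_Pow)
      then show ?thesis
        using that assms by (simp add: realization_Pow)
    qed (use that assms in \<open>simp add: realization_Pow\<close>)
    then show ?thesis
      using that assms by (auto simp: realization_Pow)
  qed
  ultimately show ?thesis
    by (metis compact_Int_closed inf.absorb_iff2 subsetI)
qed

lemma closed_realization:
  assumes "finite_complex \<Delta>"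
  shows "closed (realization \<Delta>)"
proof -
  have "\<Delta> = (\<Union>\<sigma>\<in>\<Delta>. Pow \<sigma>)"
    using finite_complexD(3)[OF assms] by auto
  then have "realization \<Delta> = (\<Union>\<sigma>\<in>\<Delta>. realization (Pow \<sigma>))"
    by (metis realization_UN)
  then show ?thesis
    using finite_complexD[OF assms] by (auto intro!: closed_UN closed_realization_Pow)
qed

section \<open>Contractions and deformations\<close>

lemma homotopic_canonI:
  fixes h :: "real \<times> 'a::topological_space \<Rightarrow> 'b::topological_space"
  assumes "continuous_on ({0..1} \<times> S) h" "\<And>t x. \<lbrakk>0 \<le> t; t \<le> 1; x \<in> S\<rbrakk> \<Longrightarrow> h (t, x) \<in> T"
    and "\<And>x. x \<in> S \<Longrightarrow> h (0, x) = f x" "\<And>x. x \<in> S \<Longrightarrow> h (1, x) = g x"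
  shows "homotopic_with_canon (\<lambda>x. True) S T f g"
proof -
  have "h \<in> {0..1} \<times> S \<rightarrow> T" using assms(2) by auto
  then show ?thesis
    using assms by (subst homotopic_with) (auto intro!: exI[of _ h])
qed

lemma contractible_contraction:
  fixes S :: "'a::topological_space set"
  assumes "contractible S" "S \<noteq> {}"
  shows "\<exists>h a. a \<in> S \<and> continuous_on ({0..1::real} \<times> S) h \<and> h \<in> {0..1} \<times> S \<rightarrow> S \<and>
    (\<forall>x\<in>S. h (0, x) = x) \<and> (\<forall>x\<in>S. h (1, x) = a)"
proof -
  obtain a where "homotopic_with_canon (\<lambda>x. True) S S id (\<lambda>x. a)"
    using assms(1) by (auto simp: contractible_def)
  then obtain h :: "real \<times> 'a \<Rightarrow> 'a"
    where h: "continuous_map (top_of_set ({0..1} \<times> S)) (top_of_set S) h"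
      "\<forall>x. h (0, x) = x" "\<forall>x. h (1, x) = a"
    unfolding homotopic_with_def prod_topology_subtopology_eu id_apply by blast
  then have hS: "continuous_on ({0..1} \<times> S) h" "h \<in> {0..1} \<times> S \<rightarrow> S"
    by auto
  moreover obtain x where "x \<in> S" using assms(2) by blast
  then have "h (1, x) \<in> S" using hS(2) by auto
  then have "a \<in> S" using h(3) by simp
  ultimately show ?thesis
    using h by blast
qed

text \<open>It is enough that the deformation ends inside \<open>S\<close>: preceded by the end map,
  the contraction of \<open>S\<close> becomes a null homotopy on \<open>T\<close>.\<close>

lemma contractible_deformation:
  fixes k :: "real \<times> 'a::topological_space \<Rightarrow> 'a"
  assumes "contractible S" "S \<subseteq> T" "continuous_on ({0..1} \<times> T) k" "k \<in> {0..1} \<times> T \<rightarrow> T"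
    and "\<And>x. x \<in> T \<Longrightarrow> k (0, x) = x" "\<And>x. x \<in> T \<Longrightarrow> k (1, x) \<in> S"
  shows "contractible T"
proof -
  let ?r = "\<lambda>x. k (1, x)"
  obtain a where a: "homotopic_with_canon (\<lambda>x. True) S S id (\<lambda>x. a)"
    using assms(1) by (auto simp: contractible_def)
  have "continuous_on T ?r"
  proof (rule continuous_on_compose2[OF assms(3)])
    show "continuous_on T (\<lambda>x. (1 :: real, x))" by (intro continuous_intros)
  qed auto
  then have "continuous_map (top_of_set T) (top_of_set S) ?r"
    using assms(6) by auto
  from homotopic_with_compose_continuous_map_right[OF a this]
  have "homotopic_with_canon (\<lambda>x. True) T S ?r (\<lambda>x. a)"
    by (simp add: o_def)
  then have "homotopic_with_canon (\<lambda>x. True) T T ?r (\<lambda>x. a)"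
    using assms(2) by (rule homotopic_with_subset_right)
  moreover have "homotopic_with_canon (\<lambda>x. True) T T id ?r"
    using assms(3-5) by (intro homotopic_canonI[of _ k]) auto
  ultimately show ?thesis
    unfolding contractible_def using homotopic_with_trans by blast
qed

lemma contractible_realization_Pow:
  assumes "finite F" "F \<noteq> {}"
  shows "contractible (realization (Pow F))"
proof -
  obtain w where w: "w \<in> F" using assms(2) by blast
  let ?e = "\<lambda>v. if v = w then 1 else 0 :: real"
  let ?h = "\<lambda>(t, x) v. (1 - t) * x v + t * ?e v"
  have "homotopic_with_canon (\<lambda>x. True) (realization (Pow F)) (realization (Pow F)) id (\<lambda>x. ?e)"
  proof (rule homotopic_canonI[of _ ?h])
    show "continuous_on ({0..1} \<times> realization (Pow F)) ?h"
      unfolding split_beta by (intro continuous_intros)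
    fix t :: real and x assume "0 \<le> t" "t \<le> 1" "x \<in> realization (Pow F)"
    then show "?h (t, x) \<in> realization (Pow F)"
      using w assms by (auto simp: realization_Pow sum.distrib simp flip: sum_distrib_left)
  qed auto
  then show ?thesis
    by (auto simp: contractible_def)
qed

text \<open>
  The new simplex deforms onto its faces \<open>F - {v}\<close> with \<open>v \<in> R\<close> by moving mass from \<open>R\<close> evenly to the
  vertices outside \<open>R\<close> until one of the coordinates in \<open>R\<close> vanishes.
\<close>

lemma contractible_realization_Un_Pow:
  assumes "finite_complex \<Delta>" "finite F" "R \<subseteq> F" "R \<noteq> {}" "R \<noteq> F"
    and faces: "\<And>\<sigma>. \<sigma> \<subseteq> F \<Longrightarrow> \<sigma> \<in> \<Delta> \<longleftrightarrow> \<not> R \<subseteq> \<sigma>"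
    and "contractible (realization \<Delta>)"
  shows "contractible (realization (\<Delta> \<union> Pow F))"
proof -
  define D where "D = realization (Pow F)"
  have finR: "finite R" using assms(2,3) finite_subset by blast
  \<comment> \<open>When each vertex of \<open>R\<close> loses one unit of mass and each vertex of
    \<open>F - R\<close> gains \<open>q\<close>, the total is unchanged.\<close>
  define q where "q = real (card R) / real (card (F - R))"
  have cFR: "card (F - R) > 0"
    using assms(2,3,5) by (auto simp: card_gt_0_iff)
  define \<mu> where "\<mu> x = Min (x ` R)" for x :: "'a \<Rightarrow> real"
  define w where "w v = (if v \<in> R then -1 else if v \<in> F then q else 0)" for v
  define p where "p = (\<lambda>(t, x) v. x v + t * \<mu> x * w v)"
  define k where "k z = (if snd z \<in> D then p z else snd z)" for z
  have D: "D = {x. (\<forall>v. 0 \<le> x v) \<and> (\<forall>v. v \<notin> F \<longrightarrow> x v = 0) \<and> sum x F = 1}"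
    unfolding D_def by (rule realization_Pow[OF assms(2)])
  have \<mu>_le: "\<mu> x \<le> x v" if "v \<in> R" for x v
    using that finR by (auto simp: \<mu>_def)
  have \<mu>_nonneg: "0 \<le> \<mu> x" if "x \<in> D" for x
    using that finR assms(4) by (auto simp: \<mu>_def D)
  have \<mu>_attained: "\<exists>v\<in>R. x v = \<mu> x" for x
  proof -
    have "\<mu> x \<in> x ` R"
      unfolding \<mu>_def using finR assms(4) by (intro Min_in) auto
    then show ?thesis by auto
  qed
  \<comment> \<open>On the overlap with the old complex \<open>p\<close> is stationary, so it can be
    pasted with the identity there.\<close>
  have \<mu>_zero: "\<mu> x = 0" if x: "x \<in> D" "x \<in> realization \<Delta>" for x
  proof -
    have "{v. x v \<noteq> 0} \<subseteq> F" "{v. x v \<noteq> 0} \<in> \<Delta>"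
      using x by (auto simp: D_def realization_def)
    then obtain v where "v \<in> R" "x v = 0" using faces by auto
    then show ?thesis using \<mu>_le[of v x] \<mu>_nonneg[OF x(1)] by simp
  qed
  have pD: "p (t, x) \<in> D" if t: "0 \<le> t" "t \<le> 1" and x: "x \<in> D" for t x
  proof -
    have "0 \<le> p (t, x) v" for v
    proof (cases "v \<in> R")
      case True
      have "t * \<mu> x \<le> 1 * \<mu> x"
        using t \<mu>_nonneg[OF x] by (intro mult_right_mono) auto
      then show ?thesis using True \<mu>_le[OF True, of x] by (simp add: p_def w_def)
    next
      case False
      then show ?thesis
        using x t \<mu>_nonneg[OF x] by (auto simp: p_def w_def D q_def)
    qed
    moreover have "p (t, x) v = 0" if "v \<notin> F" for v
      using that x assms(3) by (auto simp: p_def w_def D)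
    moreover have "sum (p (t, x)) F = 1"
    proof -
      have "sum w F = sum w R + sum w (F - R)"
        using assms(2,3) by (subst sum.subset_diff[of R F w], auto)
      also have "\<dots> = - real (card R) + real (card (F - R)) * q"
        using assms(3) by (simp add: w_def)
      also have "\<dots> = 0"
        using cFR by (simp add: q_def)
      finally have "sum w F = 0" .
      then show ?thesis
        using x by (simp add: p_def D sum.distrib flip: sum_distrib_left)
    qed
    ultimately show ?thesis by (simp add: D)
  qed
  have p1: "p (1, x) \<in> realization \<Delta>" if x: "x \<in> D" for x
  proof (rule realization_Pow_face[of _ F])
    show "p (1, x) \<in> realization (Pow F)"
      using pD[of 1 x] x by (simp add: D_def)
    obtain v where "v \<in> R" "x v = \<mu> x" using \<mu>_attained by blast
    then have "\<not> R \<subseteq> {v. p (1, x) v \<noteq> 0}"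
      by (auto simp: p_def w_def)
    moreover have "{v. p (1, x) v \<noteq> 0} \<subseteq> F"
      using pD[of 1 x] x by (auto simp: D)
    ultimately show "{v. p (1, x) v \<noteq> 0} \<in> \<Delta>"
      using faces by simp
  qed
  have eq: "realization (\<Delta> \<union> Pow F) = D \<union> realization \<Delta>"
    by (auto simp: realization_Un D_def)
  show ?thesis
  proof (rule contractible_deformation[OF assms(7)])
    show "realization \<Delta> \<subseteq> realization (\<Delta> \<union> Pow F)"
      by (rule realization_mono) simp
    have "continuous_on ({0..1} \<times> D \<union> {0..1} \<times> realization \<Delta>) k"
      unfolding k_def
    proof (rule continuous_on_cases)
      show "closed ({0..1::real} \<times> D)" "closed ({0..1::real} \<times> realization \<Delta>)"
        using assms(1,2) by (auto simp: D_def intro!: closed_Times closed_realization closed_realization_Pow)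
      show "continuous_on ({0..1} \<times> D) p"
        unfolding p_def split_beta \<mu>_def
        by (intro continuous_intros finR assms(4))
      show "\<forall>z. z \<in> {0..1} \<times> D \<and> snd z \<notin> D \<or> z \<in> {0..1} \<times> realization \<Delta> \<and> snd z \<in> D \<longrightarrow> p z = snd z"
        using \<mu>_zero by (auto simp: p_def)
    qed (intro continuous_intros)
    then show "continuous_on ({0..1} \<times> realization (\<Delta> \<union> Pow F)) k"
      by (simp add: eq Sigma_Un_distrib2)
    show "k \<in> {0..1} \<times> realization (\<Delta> \<union> Pow F) \<rightarrow> realization (\<Delta> \<union> Pow F)"
      using pD by (auto simp: k_def eq split: if_splits)
  qed (use p1 in \<open>auto simp: k_def p_def eq\<close>)
qed

section \<open>Collapsing a contractible subspace\<close>

text \<open>The homotopy maps \<open>C\<close> into \<open>C\<close> at all times, so it descends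
  along \<open>f\<close>. At time 1 it is constant on \<open>C\<close>, so it factors through
  \<open>f\<close>, and the factor \<open>g\<close> is a homotopy inverse.\<close>

lemma homotopy_equivalent_collapse:
  assumes q: "quotient_map X W f"
    and H: "continuous_map (prod_topology (top_of_set {0..1::real}) X) X H"
    and H0: "\<And>x. x \<in> topspace X \<Longrightarrow> H (0, x) = x"
    and HC: "\<And>t x. \<lbrakk>0 \<le> t; t \<le> 1; x \<in> C\<rbrakk> \<Longrightarrow> H (t, x) \<in> C"
    and H1: "\<And>x y. x \<in> C \<Longrightarrow> y \<in> C \<Longrightarrow> H (1, x) = H (1, y)"
    and fC: "\<And>x y. x \<in> C \<Longrightarrow> y \<in> C \<Longrightarrow> f x = f y"
    and inj: "\<And>x y. \<lbrakk>x \<in> topspace X; y \<in> topspace X; f x = f y\<rbrakk> \<Longrightarrow> x = y \<or> x \<in> C \<and> y \<in> C"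
  shows "X homotopy_equivalent_space W"
proof -
  let ?I = "top_of_set {0..1::real}"
  have H1X: "continuous_map X X (\<lambda>x. H (1, x))"
    using continuous_map_compose[OF _ H, of X "\<lambda>x. (1, x)"]
    by (simp add: o_def continuous_map_pairwise)
  obtain g where g: "continuous_map W X g" "\<And>x. x \<in> topspace X \<Longrightarrow> g (f x) = H (1, x)"
  proof (rule quotient_map_lift_exists[OF q H1X])
    fix x y assume "x \<in> topspace X" "y \<in> topspace X" "f x = f y"
    then show "H (1, x) = H (1, y)"
      using inj[of x y] H1 by auto
  qed (use that in blast)
  have f: "continuous_map X W f"
    using q by (rule quotient_imp_continuous_map)
  have gf: "homotopic_with (\<lambda>x. True) X X (g \<circ> f) id"
  proof -
    have "homotopic_with (\<lambda>x. True) X X id (g \<circ> f)"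
      using H H0 g(2) by (subst homotopic_with) (auto intro!: exI[of _ H])
    then show ?thesis
      by (simp add: homotopic_with_sym)
  qed
  have fg: "homotopic_with (\<lambda>x. True) W W (f \<circ> g) id"
  proof -
    let ?q = "\<lambda>(t, x). (t, f x)"
    have loc: "locally_compact_space ?I" "Hausdorff_space ?I"
      by (auto simp: compact_imp_locally_compact_space compact_space_subtopology Hausdorff_space_subtopology)
    \<comment> \<open>The interval is locally compact Hausdorff, so its product with a quotient map
      is a quotient map; this gives the descended homotopy its joint continuity.\<close>
    have Q: "quotient_map (prod_topology ?I X) (prod_topology ?I W) ?q"
      using loc q by (intro quotient_map_prod_right) auto
    have fH: "continuous_map (prod_topology ?I X) W (f \<circ> H)"
      using H f by (rule continuous_map_compose)
    obtain K where K: "continuous_map (prod_topology ?I W) W K"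
      "\<And>z. z \<in> topspace (prod_topology ?I X) \<Longrightarrow> K (?q z) = (f \<circ> H) z"
    proof (rule quotient_map_lift_exists[OF Q fH])
      fix z z' assume z: "z \<in> topspace (prod_topology ?I X)" "z' \<in> topspace (prod_topology ?I X)" "?q z = ?q z'"
      then obtain t x y where zz: "z = (t, x)" "z' = (t, y)" "0 \<le> t" "t \<le> 1" "x \<in> topspace X" "y \<in> topspace X" "f x = f y"
        by auto
      then show "(f \<circ> H) z = (f \<circ> H) z'"
        using inj[of x y] HC[of t] fC by auto
    qed (use that in blast)
    have surj: "\<exists>x\<in>topspace X. w = f x" if "w \<in> topspace W" for w
      using quotient_imp_surjective_map[OF q] that by blast
    have "K (0, w) = w \<and> K (1, w) = f (g w)" if w: "w \<in> topspace W" for w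
    proof -
      obtain x where "x \<in> topspace X" "w = f x"
        using surj w by blast
      then show ?thesis
        using K(2)[of "(0, x)"] K(2)[of "(1, x)"] H0 g(2) by auto
    qed
    then have "homotopic_with (\<lambda>x. True) W W id (f \<circ> g)"
      using K(1) by (subst homotopic_with) (auto intro!: exI[of _ K])
    then show ?thesis
      by (simp add: homotopic_with_sym)
  qed
  show ?thesis
    unfolding homotopy_equivalent_space_def using f g(1) gf fg by blast
qed


section \<open>A simplex modulo its boundary\<close>

abbreviation sphere_base :: "nat \<Rightarrow> real" where
  "sphere_base \<equiv> \<lambda>i. if i = 0 then 1 else 0"

lemma Hausdorff_nsphere: "Hausdorff_space (nsphere d)"
  unfolding nsphere_def by (intro Hausdorff_space_subtopology Hausdorff_Euclidean_space)

lemma topspace_nsphere: "topspace (nsphere d) = {x. (\<Sum>i\<le>d. x i ^ 2) = 1 \<and> (\<forall>i>d. x i = 0)}"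
  by (simp add: nsphere)

lemma nsphere_eq: "nsphere d = top_of_set {x. (\<Sum>i\<le>d. x i ^ 2) = 1 \<and> (\<forall>i>d. x i = 0)}"
  by (simp add: nsphere euclidean_product_topology)

lemma sum_atMost_split_0:
  fixes f :: "nat \<Rightarrow> real"
  shows "(\<Sum>i\<le>d. f i) = f 0 + (\<Sum>i\<in>{1..d}. f i)"
proof -
  have "{..d} = insert 0 {1..d}" by auto
  then show ?thesis by simp
qed

text \<open>
  With \<open>z = (u - b) / \<mu>\<close>, where \<open>b\<close> is the barycentre and \<open>\<mu>\<close> the least coordinate, this is the inverse
  stereographic projection \<open>z \<mapsto> ((\<bar>z\<bar>\<^sup>2 - 1, 2 z) / (\<bar>z\<bar>\<^sup>2 + 1))\<close> of the coordinates \<open>1, \<dots>, d\<close> of \<open>z\<close>. The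
  denominators are cleared so that the boundary \<open>\<mu> = 0\<close> is sent to the base point.
\<close>

definition simplex_sphere :: "nat \<Rightarrow> (nat \<Rightarrow> real) \<Rightarrow> nat \<Rightarrow> real" where
  "simplex_sphere d u =
     (let b = 1 / real (Suc d); \<mu> = Min (u ` {..d}); r = (\<Sum>j\<in>{1..d}. (u j - b)\<^sup>2)
      in (\<lambda>j. if j = 0 then (r - \<mu>\<^sup>2) / (r + \<mu>\<^sup>2)
              else if j \<le> d then 2 * \<mu> * (u j - b) / (r + \<mu>\<^sup>2) else 0))"

text \<open>Only the coordinates up to \<open>d\<close> are constrained, so \<open>T\<close> accepts
  \<open>x \<circ> e\<close> for any enumeration \<open>e\<close> of the vertices, whatever its
  values beyond \<open>d\<close>. Accordingly injectivity is claimed for the coordinates up to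
  \<open>d\<close>.\<close>

context
  fixes d :: nat and T :: "(nat \<Rightarrow> real) set"
  defines "T \<equiv> {u. (\<forall>j\<le>d. 0 \<le> u j) \<and> (\<Sum>j\<le>d. u j) = 1}"
begin

definition barycoord :: real where "barycoord = 1 / real (Suc d)"
definition mincoord :: "(nat \<Rightarrow> real) \<Rightarrow> real" where "mincoord u = Min (u ` {..d})"
text \<open>Coordinate 0 is left out because the deviations from the barycentre sum to zero: the
  other \<open>d\<close> coordinates parametrize the simplex.\<close>

definition sqdist :: "(nat \<Rightarrow> real) \<Rightarrow> real" where "sqdist u = (\<Sum>j\<in>{1..d}. (u j - barycoord)\<^sup>2)"

lemma simplex_sphere_eq:
  "simplex_sphere d u j =
    (if j = 0 then (sqdist u - (mincoord u)\<^sup>2) / (sqdist u + (mincoord u)\<^sup>2)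
     else if j \<le> d then 2 * mincoord u * (u j - barycoord) / (sqdist u + (mincoord u)\<^sup>2) else 0)"
  by (simp add: simplex_sphere_def Let_def barycoord_def mincoord_def sqdist_def)

lemma barycoord_pos: "0 < barycoord" "real (Suc d) * barycoord = 1"
  by (auto simp: barycoord_def)

lemma mincoord_le: "j \<le> d \<Longrightarrow> mincoord u \<le> u j"
  by (simp add: mincoord_def)

lemma mincoord_attained: "\<exists>j\<le>d. u j = mincoord u"
proof -
  have "mincoord u \<in> u ` {..d}"
    unfolding mincoord_def by (intro Min_in) auto
  then show ?thesis by auto
qed

lemma mincoord_nonneg: "u \<in> T \<Longrightarrow> 0 \<le> mincoord u"
  using mincoord_attained[of u] by (auto simp: T_def)

lemma sqdist_nonneg: "0 \<le> sqdist u"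
  by (auto simp: sqdist_def intro: sum_nonneg)

lemma sum_deviation: "u \<in> T \<Longrightarrow> (\<Sum>j\<le>d. u j - barycoord) = 0"
  using barycoord_pos(2) by (simp add: T_def sum_subtractf)

text \<open>Both terms could vanish only if \<open>u\<close> were the barycentre and a boundary
  point at once.\<close>

lemma sqdist_mincoord_pos:
  assumes "u \<in> T"
  shows "0 < sqdist u + (mincoord u)\<^sup>2"
proof (rule ccontr)
  assume "\<not> ?thesis"
  then have "sqdist u + (mincoord u)\<^sup>2 \<le> 0" by simp
  then have "sqdist u = 0 \<and> (mincoord u)\<^sup>2 = 0"
    using sqdist_nonneg[of u] zero_le_power2[of "mincoord u"] by linarith
  then have "sqdist u = 0" "mincoord u = 0" by auto
  then have "\<forall>j\<in>{1..d}. u j = barycoord"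
    unfolding sqdist_def by (subst (asm) sum_nonneg_eq_0_iff) auto
  then have "(\<Sum>j\<le>d. u j - barycoord) = u 0 - barycoord"
    by (simp add: sum_atMost_split_0)
  then have "u 0 = barycoord"
    using sum_deviation[OF assms] by simp
  with \<open>\<forall>j\<in>{1..d}. u j = barycoord\<close> have "u j = barycoord" if "j \<le> d" for j
    using that by (cases j) auto
  with mincoord_attained[of u] have "mincoord u = barycoord" by auto
  with \<open>mincoord u = 0\<close> show False using barycoord_pos by simp
qed

lemma simplex_sphere_in_nsphere:
  assumes "u \<in> T"
  shows "simplex_sphere d u \<in> topspace (nsphere d)"
proof -
  let ?m = "mincoord u" and ?r = "sqdist u"
  have "(\<Sum>j\<in>{1..d}. (simplex_sphere d u j)\<^sup>2) = (\<Sum>j\<in>{1..d}. 4 * ?m\<^sup>2 / (?r + ?m\<^sup>2)\<^sup>2 * (u j - barycoord)\<^sup>2)"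
    by (intro sum.cong) (auto simp: simplex_sphere_eq power_mult_distrib power_divide)
  also have "\<dots> = 4 * ?m\<^sup>2 / (?r + ?m\<^sup>2)\<^sup>2 * ?r"
    by (simp add: sqdist_def sum_distrib_left)
  finally have "(\<Sum>j\<le>d. (simplex_sphere d u j)\<^sup>2) = ((?r - ?m\<^sup>2)\<^sup>2 + 4 * ?m\<^sup>2 * ?r) / (?r + ?m\<^sup>2)\<^sup>2"
    by (simp add: sum_atMost_split_0 simplex_sphere_eq power_divide add_divide_distrib)
  also have "(?r - ?m\<^sup>2)\<^sup>2 + 4 * ?m\<^sup>2 * ?r = (?r + ?m\<^sup>2)\<^sup>2"
    by (simp add: power2_eq_square algebra_simps)
  finally show ?thesis
    using sqdist_mincoord_pos[OF assms] by (auto simp: topspace_nsphere simplex_sphere_eq)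
qed

lemma simplex_sphere_eq_base_iff:
  assumes "u \<in> T"
  shows "simplex_sphere d u = sphere_base \<longleftrightarrow> mincoord u = 0"
proof
  assume "simplex_sphere d u = sphere_base"
  then have "simplex_sphere d u 0 = 1" by simp
  then show "mincoord u = 0"
    using sqdist_mincoord_pos[OF assms] by (simp add: simplex_sphere_eq field_simps)
next
  assume "mincoord u = 0"
  then show "simplex_sphere d u = sphere_base"
    using sqdist_mincoord_pos[OF assms] by (auto simp: simplex_sphere_eq)
qed

text \<open>Stereographic projection recovers \<open>z = (u - b) / \<mu>\<close> from the image, and
  \<open>z\<close> recovers \<mu>: its least coordinate is \<open>1 - b / \<mu>\<close>, which
  increases with \<mu>.\<close>

lemma simplex_sphere_inj:
  assumes u: "u \<in> T" "mincoord u \<noteq> 0" and v: "v \<in> T" "mincoord v \<noteq> 0"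
    and eq: "simplex_sphere d u = simplex_sphere d v" and j: "j \<le> d"
  shows "u j = v j"
proof -
  define z where "z w j = (w j - barycoord) / mincoord w" for w j
  have pos: "0 < mincoord u" "0 < mincoord v"
    using u v mincoord_nonneg by fastforce+
  have z_sphere: "z w j = simplex_sphere d w j / (1 - simplex_sphere d w 0)"
    if "w \<in> T" "0 < mincoord w" "j \<in> {1..d}" for w j
  proof -
    have "1 - simplex_sphere d w 0 = 2 * (mincoord w)\<^sup>2 / (sqdist w + (mincoord w)\<^sup>2)"
      using sqdist_mincoord_pos[OF that(1)] by (simp add: simplex_sphere_eq field_simps)
    then show ?thesis
      using that sqdist_mincoord_pos[OF that(1)]
      by (simp add: z_def simplex_sphere_eq power2_eq_square)
  qed
  have z0: "z w 0 = - (\<Sum>j\<in>{1..d}. z w j)" if "w \<in> T" for w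
  proof -
    have "(w 0 - barycoord) + (\<Sum>j\<in>{1..d}. w j - barycoord) = 0"
      using sum_deviation[OF that] by (simp only: sum_atMost_split_0)
    then have "w 0 - barycoord = - (\<Sum>j\<in>{1..d}. w j - barycoord)" by linarith
    then show ?thesis
      by (simp only: z_def sum_divide_distrib[symmetric] minus_divide_left)
  qed
  have z_eq: "z u j = z v j" if "j \<le> d" for j
  proof (cases "j = 0")
    case True
    have "(\<Sum>j\<in>{1..d}. z u j) = (\<Sum>j\<in>{1..d}. z v j)"
      using u v pos eq by (intro sum.cong) (auto simp: z_sphere)
    then show ?thesis
      using True z0 u v by simp
  qed (use that u v pos eq in \<open>auto simp: z_sphere\<close>)
  \<comment> \<open>Compare the two points at an index where \<open>w\<close> is least; exchanging
    their roles gives equality.\<close>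
  have le: "mincoord w' \<le> mincoord w"
    if "0 < mincoord w" "0 < mincoord w'" "\<And>j. j \<le> d \<Longrightarrow> z w j = z w' j" for w w'
  proof -
    obtain i where i: "i \<le> d" "w i = mincoord w" using mincoord_attained by blast
    have "1 - barycoord / mincoord w = z w i"
      using i that(1) by (simp add: z_def diff_divide_distrib)
    also have "\<dots> = z w' i" using that i by simp
    also have "\<dots> \<ge> (mincoord w' - barycoord) / mincoord w'"
      using mincoord_le[OF i(1), of w'] that(2) by (auto simp: z_def intro!: divide_right_mono)
    finally have "barycoord / mincoord w \<le> barycoord / mincoord w'"
      using that(2) by (simp add: diff_divide_distrib)
    then show ?thesis
      using barycoord_pos(1) that by (simp add: field_simps)
  qed
  have "mincoord u = mincoord v"
    using le[of u v] le[of v u] pos z_eq by (simp add: order.antisym)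
  with z_eq[OF j] pos show ?thesis
    by (simp add: z_def)
qed

lemma simplex_sphere_surj:
  assumes s: "s \<in> topspace (nsphere d)" and "1 \<le> d"
  shows "\<exists>u\<in>T. simplex_sphere d u = s"
proof (cases "s 0 = 1")
  case True
  have s': "(\<Sum>i\<le>d. (s i)\<^sup>2) = 1" "\<forall>i>d. s i = 0"
    using s by (auto simp: topspace_nsphere)
  then have "(\<Sum>i\<in>{1..d}. (s i)\<^sup>2) = 0"
    using True by (simp add: sum_atMost_split_0)
  then have "\<forall>i\<in>{1..d}. s i = 0"
    by (subst (asm) sum_nonneg_eq_0_iff) auto
  with s' True have "s = sphere_base"
    by (auto simp: fun_eq_iff)
  \<comment> \<open>The base point of the sphere, read as a point of the simplex, is a vertex. It
    lies on the boundary because \<open>1 \<le> d\<close> provides a coordinate equal to 0.\<close>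
  moreover have base: "sphere_base \<in> T"
    by (simp add: T_def sum_atMost_split_0)
  moreover have "mincoord sphere_base = 0"
    using mincoord_nonneg[OF base] mincoord_le[of 1 sphere_base] assms(2) by simp
  ultimately show ?thesis
    using simplex_sphere_eq_base_iff by blast
next
  case False
  have s': "(\<Sum>i\<le>d. (s i)\<^sup>2) = 1" "\<forall>i>d. s i = 0"
    using s by (auto simp: topspace_nsphere)
  define w where "w j = s j / (1 - s 0)" for j
  \<comment> \<open>Coordinate 0 is dictated by the requirement that the deviations sum to
    zero.\<close>
  define z where "z j = (if j = 0 then - (\<Sum>i\<in>{1..d}. w i) else w j)" for j
  have "(s 0)\<^sup>2 \<le> 1"
    using s'(1) sum_nonneg[of "{1..d}" "\<lambda>i. (s i)\<^sup>2"] by (simp add: sum_atMost_split_0)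
  then have "s 0 \<le> 1" by (metis abs_le_square_iff abs_one one_power2 abs_ge_self order.trans)
  with False have s0: "s 0 < 1" by simp
  have sumz: "(\<Sum>j\<le>d. z j) = 0"
    by (simp add: sum_atMost_split_0 z_def)
  define \<zeta> where "\<zeta> = Min (z ` {..d})"
  have \<zeta>_le: "\<zeta> \<le> z j" if "j \<le> d" for j
    using that by (simp add: \<zeta>_def)
  have "\<zeta> \<in> z ` {..d}"
    unfolding \<zeta>_def by (intro Min_in) auto
  then obtain i where i: "i \<le> d" "z i = \<zeta>" by auto
  have "real (Suc d) * \<zeta> \<le> 0"
    using sum_bounded_below[of "{..d}" \<zeta> z] \<zeta>_le sumz by simp
  then have "\<zeta> \<le> 0" by (simp add: mult_le_0_iff)
  \<comment> \<open>The solution of \<open>1 - b / \<mu> = \<zeta>\<close>, the relation between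
    \<mu> and the least coordinate of \<open>z\<close>. It is positive since
    \<open>\<zeta> \<le> 0\<close>.\<close>
  define \<mu> where "\<mu> = barycoord / (1 - \<zeta>)"
  have \<mu>: "0 < \<mu>" "barycoord = \<mu> * (1 - \<zeta>)"
    using \<open>\<zeta> \<le> 0\<close> barycoord_pos(1) by (auto simp: \<mu>_def)
  define u where "u j = barycoord + \<mu> * z j" for j
  have u_alt: "u j = \<mu> * (1 + (z j - \<zeta>))" for j
    by (simp add: u_def \<mu>(2) algebra_simps)
  have u_ge: "\<mu> \<le> u j" if "j \<le> d" for j
    using \<mu>(1) \<zeta>_le[OF that] unfolding u_alt by (simp add: algebra_simps)
  have uT: "u \<in> T"
  proof -
    have "(\<Sum>j\<le>d. u j) = real (Suc d) * barycoord + \<mu> * (\<Sum>j\<le>d. z j)"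
      by (simp add: u_def sum.distrib sum_distrib_left)
    then show ?thesis
      using barycoord_pos(2) sumz u_ge \<mu>(1) by (force simp: T_def)
  qed
  have mu: "mincoord u = \<mu>"
    unfolding mincoord_def
  proof (rule Min_eqI)
    show "\<mu> \<in> u ` {..d}"
      using i u_alt[of i] by (intro image_eqI[of _ _ i]) auto
  qed (use u_ge in auto)
  have z1: "z j = s j / (1 - s 0)" if "j \<in> {1..d}" for j
    using that by (auto simp: z_def w_def)
  have "sqdist u = (\<Sum>j\<in>{1..d}. \<mu>\<^sup>2 / (1 - s 0)\<^sup>2 * (s j)\<^sup>2)"
    unfolding sqdist_def by (intro sum.cong) (auto simp: u_def z1 power_mult_distrib power_divide)
  also have "\<dots> = \<mu>\<^sup>2 / (1 - s 0)\<^sup>2 * (\<Sum>j\<in>{1..d}. (s j)\<^sup>2)"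
    by (simp add: sum_distrib_left)
  also have "(\<Sum>j\<in>{1..d}. (s j)\<^sup>2) = (1 - s 0) * (1 + s 0)"
    using s'(1) by (simp add: sum_atMost_split_0 power2_eq_square algebra_simps)
  also have "\<mu>\<^sup>2 / (1 - s 0)\<^sup>2 * ((1 - s 0) * (1 + s 0)) = \<mu>\<^sup>2 * (1 + s 0) / (1 - s 0)"
    using s0 by (simp add: power2_eq_square)
  finally have r: "sqdist u = \<mu>\<^sup>2 * (1 + s 0) / (1 - s 0)" .
  have sum: "sqdist u + \<mu>\<^sup>2 = 2 * \<mu>\<^sup>2 / (1 - s 0)"
    unfolding r using s0 by (simp add: field_simps)
  have diff: "sqdist u - \<mu>\<^sup>2 = 2 * \<mu>\<^sup>2 * s 0 / (1 - s 0)"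
    unfolding r using s0 by (simp add: field_simps)
  have "simplex_sphere d u j = s j" for j
  proof -
    consider "j = 0" | "j \<in> {1..d}" | "j > d" by force
    then show ?thesis
    proof cases
      case 1
      then show ?thesis
        using s0 \<mu>(1) by (simp add: simplex_sphere_eq mu sum diff)
    next
      case 2
      have "simplex_sphere d u j = 2 * \<mu> * (\<mu> * (s j / (1 - s 0))) / (2 * \<mu>\<^sup>2 / (1 - s 0))"
        using 2 by (auto simp: simplex_sphere_eq mu sum u_def z1)
      then show ?thesis
        using s0 \<mu>(1) by (simp add: power2_eq_square)
    qed (use s' in \<open>simp add: simplex_sphere_eq\<close>)
  qed
  with uT show ?thesis by blast
qed

end

text \<open>A continuous surjection from a compact space onto a Hausdorff space is a quotient map,
  so no inverse has to be shown continuous. The other two clauses say that exactly the boundary is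
  collapsed.\<close>

lemma simplex_modulo_boundary_sphere:
  assumes F: "finite F" "card F = Suc d" and d: "1 \<le> d"
  shows "\<exists>p. quotient_map (top_of_set (realization (Pow F))) (nsphere d) p \<and>
    (\<forall>x\<in>realization (Pow F). p x = sphere_base \<longleftrightarrow> {v. x v \<noteq> 0} \<noteq> F) \<and>
    inj_on p {x \<in> realization (Pow F). {v. x v \<noteq> 0} = F}"
proof -
  let ?D = "realization (Pow F)"
  let ?T = "{u. (\<forall>j\<le>d. 0 \<le> u j) \<and> (\<Sum>j\<le>d. u j) = (1::real)}"
  have "\<exists>e. bij_betw e {..d} F"
    using F ex_bij_betw_nat_finite[of F] by (metis atLeast0LessThan lessThan_Suc_atMost)
  then obtain e where e: "bij_betw e {..d} F" by blast
  have eF: "e j \<in> F" if "j \<le> d" for j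
    using e that by (auto simp: bij_betw_def)
  define p where "p x = simplex_sphere d (x \<circ> e)" for x :: "'a \<Rightarrow> real"
  have D: "?D = {x. (\<forall>v. 0 \<le> x v) \<and> (\<forall>v. v \<notin> F \<longrightarrow> x v = 0) \<and> sum x F = 1}"
    by (rule realization_Pow[OF F(1)])
  have sum_e: "(\<Sum>j\<le>d. x (e j)) = sum x F" for x :: "'a \<Rightarrow> real"
    using e by (rule sum.reindex_bij_betw)
  have T: "x \<circ> e \<in> ?T" if "x \<in> ?D" for x
    using that by (auto simp: D sum_e)
  have boundary: "mincoord d (x \<circ> e) = 0 \<longleftrightarrow> {v. x v \<noteq> 0} \<noteq> F" if x: "x \<in> ?D" for x
  proof
    assume "mincoord d (x \<circ> e) = 0"
    then obtain j where "j \<le> d" "x (e j) = 0"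
      using mincoord_attained[of d "x \<circ> e"] by auto
    then show "{v. x v \<noteq> 0} \<noteq> F" using eF by blast
  next
    assume "{v. x v \<noteq> 0} \<noteq> F"
    then obtain v where "v \<in> F" "x v = 0" using x by (auto simp: D)
    moreover from this obtain j where "j \<le> d" "v = e j"
      using e by (auto simp: bij_betw_def)
    ultimately have "mincoord d (x \<circ> e) \<le> 0"
      using mincoord_le[of j d "x \<circ> e"] by simp
    then show "mincoord d (x \<circ> e) = 0"
      using mincoord_nonneg[OF T[OF x]] by simp
  qed
  show ?thesis
  proof (intro exI[of _ p] conjI ballI)
    show "quotient_map (top_of_set ?D) (nsphere d) p"
    proof (rule continuous_imp_quotient_map)
      have "continuous_on ?D p"
      proof (rule continuous_on_coordinatewise_then_product)
        fix j
        have coord: "continuous_on ?D (\<lambda>x. (x \<circ> e) i)" for i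
          unfolding o_def by (rule continuous_on_product_then_coordinatewise[OF continuous_on_id])
        have "continuous_on ?D (\<lambda>x. mincoord d (x \<circ> e))"
          unfolding mincoord_def by (intro continuous_on_Min_image coord) auto
        moreover have "continuous_on ?D (\<lambda>x. sqdist d (x \<circ> e))"
          unfolding sqdist_def by (intro continuous_intros coord)
        moreover have "sqdist d (x \<circ> e) + (mincoord d (x \<circ> e))\<^sup>2 \<noteq> 0" if "x \<in> ?D" for x
          using sqdist_mincoord_pos[OF T[OF that]] by simp
        ultimately show "continuous_on ?D (\<lambda>x. p x j)"
          unfolding p_def simplex_sphere_eq
          by (cases "j = 0"; cases "j \<le> d") (auto intro!: continuous_intros coord coord[unfolded o_apply])
      qed
      moreover have "p x \<in> topspace (nsphere d)" if "x \<in> ?D" for x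
        unfolding p_def by (rule simplex_sphere_in_nsphere[OF T[OF that]])
      ultimately show "continuous_map (top_of_set ?D) (nsphere d) p"
        by (auto simp: nsphere_eq)
      have "s \<in> p ` ?D" if s: "s \<in> topspace (nsphere d)" for s
      proof -
        obtain u where u: "u \<in> ?T" "simplex_sphere d u = s"
          using simplex_sphere_surj[OF s d] by blast
        define x where "x v = (if v \<in> F then u (inv_into {..d} e v) else 0)" for v
        have xe: "x (e j) = u j" if "j \<le> d" for j
          using that e eF by (simp add: x_def bij_betw_inv_into_left)
        have "inv_into {..d} e v \<le> d" if "v \<in> F" for v
          using that e bij_betw_inv_into by (metis atMost_iff bij_betwE)
        moreover have "sum x F = 1"
          using u(1) xe by (simp flip: sum_e)
        ultimately have "x \<in> ?D"
          using u(1) by (auto simp: D x_def)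
        moreover have "simplex_sphere d (x \<circ> e) = simplex_sphere d u"
        proof -
          have "(x \<circ> e) ` {..d} = u ` {..d}" using xe by auto
          then have "mincoord d (x \<circ> e) = mincoord d u" by (simp only: mincoord_def)
          moreover have "sqdist d (x \<circ> e) = sqdist d u" by (simp add: sqdist_def xe)
          ultimately show ?thesis by (auto simp: fun_eq_iff simplex_sphere_eq xe)
        qed
        ultimately show ?thesis
          using u(2) by (auto simp: p_def image_iff)
      qed
      with \<open>\<And>x. x \<in> ?D \<Longrightarrow> p x \<in> topspace (nsphere d)\<close>
      show "p ` topspace (top_of_set ?D) = topspace (nsphere d)" by auto
      show "compact_space (top_of_set ?D)"
        using compact_realization_Pow[OF F(1)] by (simp add: compact_space_subtopology)
    qed (rule Hausdorff_nsphere)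
    show "p x = sphere_base \<longleftrightarrow> {v. x v \<noteq> 0} \<noteq> F" if "x \<in> ?D" for x
      unfolding p_def simplex_sphere_eq_base_iff[OF T[OF that]] by (rule boundary[OF that])
    show "inj_on p {x \<in> ?D. {v. x v \<noteq> 0} = F}"
    proof (rule inj_onI)
      fix x y assume x: "x \<in> {x \<in> ?D. {v. x v \<noteq> 0} = F}" and y: "y \<in> {x \<in> ?D. {v. x v \<noteq> 0} = F}"
        and "p x = p y"
      have "x (e j) = y (e j)" if "j \<le> d" for j
        using simplex_sphere_inj[OF T _ T, of x y j] boundary[of x] boundary[of y] x y \<open>p x = p y\<close> that
        by (auto simp: p_def)
      then have "x v = y v" if "v \<in> F" for v
        using e that by (force simp: bij_betw_def)
      moreover have "x v = y v" if "v \<notin> F" for v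
        using that x y by (auto simp: D)
      ultimately show "x = y" by blast
    qed
  qed
qed


section \<open>Homotopy type of shellable complexes\<close>

text \<open>The dilation by \<open>s\<close> about the barycentre of the simplex on
  \<open>F\<close>.\<close>

definition radial :: "'a set \<Rightarrow> real \<Rightarrow> ('a \<Rightarrow> real) \<Rightarrow> 'a \<Rightarrow> real" where
  "radial F s x v = (if v \<in> F then 1 / card F + s * (x v - 1 / card F) else 0)"

text \<open>
  \<open>\<rho>\<close> is the gauge of the simplex with respect to its barycentre, equal to 1 on the boundary. At time \<open>t\<close> the
  homotopy stretches the part \<open>\<rho> \<le> 1 / (1 + t)\<close> over the whole simplex and runs the given homotopy
  \<open>h\<close> on the remaining collar.
\<close>

lemma radial_homotopy:
  assumes F: "finite F" "F \<noteq> {}"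
    and boundary: "{x \<in> realization (Pow F). {v. x v \<noteq> 0} \<noteq> F} = realization (Pow F) \<inter> C"
    and h: "continuous_on ({0..1} \<times> C) h" "h \<in> {0..1} \<times> C \<rightarrow> C" "\<And>x. x \<in> C \<Longrightarrow> h (0, x) = x"
  shows "\<exists>K. continuous_on ({0..1} \<times> realization (Pow F)) K \<and>
    K \<in> {0..1} \<times> realization (Pow F) \<rightarrow> realization (Pow F) \<union> C \<and>
    (\<forall>x\<in>realization (Pow F). K (0, x) = x) \<and>
    (\<forall>t\<in>{0..1::real}. \<forall>x\<in>realization (Pow F) \<inter> C. K (t, x) = h (t, x))"
proof -
  define D where "D = realization (Pow F)"
  define N where "N = real (card F)"
  define \<mu> where "\<mu> x = Min (x ` F)" for x :: "'a \<Rightarrow> real"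
  \<comment> \<open>Shrinking a boundary point by the factor \<open>r\<close> towards the barycentre
    raises its least coordinate from 0 to \<open>(1 - r) / N\<close>; solving for \<open>r\<close>
    gives this formula.\<close>
  define \<rho> where "\<rho> x = 1 - N * \<mu> x" for x
  have N: "0 < N" using F by (simp add: N_def card_gt_0_iff)
  have D: "D = {x. (\<forall>v. 0 \<le> x v) \<and> (\<forall>v. v \<notin> F \<longrightarrow> x v = 0) \<and> sum x F = 1}"
    unfolding D_def by (rule realization_Pow[OF F(1)])
  have \<mu>_le: "\<mu> x \<le> x v" if "v \<in> F" for x v
    using that F by (auto simp: \<mu>_def)
  have \<mu>_attained: "\<exists>v\<in>F. x v = \<mu> x" for x
  proof -
    have "\<mu> x \<in> x ` F"
      unfolding \<mu>_def using F by (intro Min_in) auto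
    then show ?thesis by auto
  qed
  have \<mu>_nonneg: "0 \<le> \<mu> x" if "x \<in> D" for x
  proof -
    obtain v where "x v = \<mu> x" using \<mu>_attained by blast
    moreover have "0 \<le> x v" using that by (simp add: D)
    ultimately show ?thesis by simp
  qed
  have \<rho>: "0 \<le> \<rho> x" "\<rho> x \<le> 1" if "x \<in> D" for x
  proof -
    have "N * \<mu> x \<le> sum x F"
      using sum_bounded_below[of F "\<mu> x" x] \<mu>_le by (simp add: N_def)
    then show "0 \<le> \<rho> x" using that by (simp add: \<rho>_def D)
    show "\<rho> x \<le> 1" using N \<mu>_nonneg[OF that] by (simp add: \<rho>_def)
  qed
  have mem_C: "x \<in> C \<longleftrightarrow> \<mu> x = 0" if x: "x \<in> D" for x
  proof -
    have "x \<in> C \<longleftrightarrow> {v. x v \<noteq> 0} \<noteq> F"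
      using boundary x unfolding D_def by blast
    also have "\<dots> \<longleftrightarrow> (\<exists>v\<in>F. x v = 0)"
      using x by (auto simp: D)
    also have "\<dots> \<longleftrightarrow> \<mu> x = 0"
    proof
      assume "\<exists>v\<in>F. x v = 0"
      then obtain v where "v \<in> F" "x v = 0" by blast
      then show "\<mu> x = 0" using \<mu>_le[of v x] \<mu>_nonneg[OF x] by simp
    qed (use \<mu>_attained[of x] in auto)
    finally show ?thesis .
  qed
  have radial_D: "radial F s x \<in> D" if x: "x \<in> D" and s: "0 \<le> s" "s * \<rho> x \<le> 1" for s x
  proof -
    have "0 \<le> radial F s x v" for v
    proof (cases "v \<in> F")
      case True
      have "0 \<le> (1 - s * \<rho> x) / N"
        using s N by simp
      also have "\<dots> = 1 / N + s * (\<mu> x - 1 / N)"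
        using N by (simp add: \<rho>_def field_simps)
      also have "\<dots> \<le> radial F s x v"
        using True s \<mu>_le[OF True, of x] by (simp add: radial_def N_def mult_left_mono)
      finally show ?thesis .
    qed (simp add: radial_def)
    moreover have "sum (radial F s x) F = 1"
    proof -
      have "sum (radial F s x) F = (\<Sum>v\<in>F. 1 / N + s * (x v - 1 / N))"
        by (intro sum.cong) (auto simp: radial_def N_def)
      also have "\<dots> = N * (1 / N) + s * (sum x F - N * (1 / N))"
        by (simp add: sum.distrib sum_subtractf N_def flip: sum_distrib_left)
      also have "\<dots> = 1"
        using x N by (simp add: D)
      finally show ?thesis .
    qed
    ultimately show ?thesis
      by (simp add: D radial_def)
  qed
  have radial_C: "radial F (1 / \<rho> x) x \<in> C" if x: "x \<in> D" and pos: "\<rho> x > 0" for x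
  proof -
    have y: "radial F (1 / \<rho> x) x \<in> D"
      using x pos by (intro radial_D) auto
    obtain v where v: "v \<in> F" "x v = \<mu> x" using \<mu>_attained by blast
    then have "radial F (1 / \<rho> x) x v = 0"
      using N pos by (simp add: radial_def \<rho>_def field_simps flip: N_def)
    then have "\<mu> (radial F (1 / \<rho> x) x) \<le> 0"
      using \<mu>_le[OF v(1)] by metis
    then show ?thesis
      using mem_C[OF y] \<mu>_nonneg[OF y] by simp
  qed
  have radial_1: "radial F 1 x = x" if "x \<in> D" for x
    using that by (auto simp: radial_def D)
  \<comment> \<open>The collar time \<open>\<rho> * (1 + t) - 1\<close> is 0 where the branches
    meet, so that \<open>h\<close> is the identity there, and \<open>t\<close> on the boundary. The
    quotient \<open>1 / \<rho>\<close> is used only where \<open>\<rho> > 0\<close>.\<close>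
  define K where "K z = (if \<rho> (snd z) * (1 + fst z) \<le> 1 then radial F (1 + fst z) (snd z)
      else h (\<rho> (snd z) * (1 + fst z) - 1, radial F (1 / \<rho> (snd z)) (snd z)))" for z
  have \<rho>_cont: "continuous_on S (\<lambda>z. \<rho> (snd z))" for S :: "(real \<times> ('a \<Rightarrow> real)) set"
    unfolding \<rho>_def \<mu>_def by (intro continuous_intros F)
  have radial_cont: "continuous_on S (\<lambda>z. radial F (s z) (snd z))"
    if "continuous_on S s" for S :: "(real \<times> ('a \<Rightarrow> real)) set" and s
  proof (rule continuous_on_coordinatewise_then_product)
    show "continuous_on S (\<lambda>z. radial F (s z) (snd z) v)" for v
      using that by (cases "v \<in> F") (auto simp: radial_def intro!: continuous_intros)
  qed
  have \<rho>_pos: "0 < \<rho> x" if "x \<in> D" "1 \<le> \<rho> x * (1 + t)" for x t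
    using \<rho>[OF that(1)] that(2) by (cases "\<rho> x = 0") auto
  have arg: "0 \<le> \<rho> x * (1 + t) - 1 \<and> \<rho> x * (1 + t) - 1 \<le> 1"
    if "x \<in> D" "1 \<le> \<rho> x * (1 + t)" "0 \<le> t" "t \<le> 1" for x t
  proof -
    have "\<rho> x * (1 + t) \<le> 1 * 2"
      using \<rho>[OF that(1)] that by (intro mult_mono) auto
    with that show ?thesis by simp
  qed
  have "continuous_on ({0..1} \<times> D) K"
    unfolding K_def
  proof (rule continuous_on_cases_le)
    show "continuous_on ({0..1} \<times> D) (\<lambda>z. \<rho> (snd z) * (1 + fst z))"
      by (intro continuous_intros \<rho>_cont)
    show "continuous_on {z \<in> {0..1} \<times> D. \<rho> (snd z) * (1 + fst z) \<le> 1} (\<lambda>z. radial F (1 + fst z) (snd z))"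
      by (intro radial_cont continuous_intros)
    let ?S = "{z \<in> {0..1} \<times> D. 1 \<le> \<rho> (snd z) * (1 + fst z)}"
    show "continuous_on ?S (\<lambda>z. h (\<rho> (snd z) * (1 + fst z) - 1, radial F (1 / \<rho> (snd z)) (snd z)))"
    proof (rule continuous_on_compose2[OF h(1)])
      have "\<forall>z\<in>?S. \<rho> (snd z) \<noteq> 0" using \<rho>_pos by force
      then show "continuous_on ?S (\<lambda>z. (\<rho> (snd z) * (1 + fst z) - 1, radial F (1 / \<rho> (snd z)) (snd z)))"
        by (intro continuous_intros radial_cont \<rho>_cont) auto
      show "(\<lambda>z. (\<rho> (snd z) * (1 + fst z) - 1, radial F (1 / \<rho> (snd z)) (snd z))) ` ?S \<subseteq> {0..1} \<times> C"
        using arg \<rho>_pos radial_C by auto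
    qed
    fix z assume z: "z \<in> {0..1} \<times> D" "\<rho> (snd z) * (1 + fst z) = 1"
    then have "0 < \<rho> (snd z)" using \<rho>_pos[of "snd z" "fst z"] by auto
    moreover from this z have "1 + fst z = 1 / \<rho> (snd z)" by (simp add: field_simps)
    moreover from calculation z have "radial F (1 / \<rho> (snd z)) (snd z) \<in> C"
      using radial_C by auto
    ultimately show "radial F (1 + fst z) (snd z) =
        h (\<rho> (snd z) * (1 + fst z) - 1, radial F (1 / \<rho> (snd z)) (snd z))"
      using h(3) z by simp
  qed
  moreover have "K (t, x) \<in> D \<union> C" if t: "0 \<le> t" "t \<le> 1" and x: "x \<in> D" for t x
  proof (cases "\<rho> x * (1 + t) \<le> 1")
    case True
    then show ?thesis
      using radial_D[OF x, of "1 + t"] t by (simp add: K_def mult.commute)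
  next
    case False
    then have "1 \<le> \<rho> x * (1 + t)" by simp
    then have "h (\<rho> x * (1 + t) - 1, radial F (1 / \<rho> x) x) \<in> C"
      using arg[OF x _ t] radial_C[OF x \<rho>_pos[OF x]] h(2) by auto
    with False show ?thesis by (simp add: K_def)
  qed
  moreover have "K (0, x) = x" if "x \<in> D" for x
    using \<rho>[OF that] radial_1[OF that] by (simp add: K_def)
  moreover have "K (t, x) = h (t, x)" if t: "0 \<le> t" "t \<le> 1" and x: "x \<in> D" "x \<in> C" for t x
  proof -
    have "\<rho> x = 1" using mem_C[OF x(1)] x(2) by (simp add: \<rho>_def)
    then show ?thesis
      using t radial_1[OF x(1)] h(3)[OF x(2)] by (cases "t = 0") (auto simp: K_def)
  qed
  ultimately have "continuous_on ({0..1} \<times> D) K \<and> K \<in> {0..1} \<times> D \<rightarrow> D \<union> C \<and>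
      (\<forall>x\<in>D. K (0, x) = x) \<and> (\<forall>t\<in>{0..1}. \<forall>x\<in>D \<inter> C. K (t, x) = h (t, x))"
    by (intro conjI funcsetI) (force, metis (no_types) SigmaE atLeastAtMost_iff, auto)
  then show ?thesis
    unfolding D_def by blast
qed

section \<open>Attaching simplices along their whole boundary\<close>

text \<open>The equal size of the cells prevents one from containing another, which confines their
  overlaps to \<open>\<Gamma>\<close>.\<close>

locale facet_attachment =
  fixes \<Gamma> G :: "'a set set" and d :: nat
  assumes complex: "finite_complex \<Gamma>"
    and finite_cells: "finite G"
    and cell: "\<And>F. F \<in> G \<Longrightarrow> finite F" "\<And>F. F \<in> G \<Longrightarrow> card F = Suc d"
    and new: "\<And>F. F \<in> G \<Longrightarrow> F \<notin> \<Gamma>"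
    and boundary: "\<And>F \<sigma>. F \<in> G \<Longrightarrow> \<sigma> \<subset> F \<Longrightarrow> \<sigma> \<in> \<Gamma>"
begin

abbreviation "C \<equiv> realization \<Gamma>"
abbreviation "X \<equiv> realization (\<Gamma> \<union> G)"

lemma realization_eq: "X = C \<union> (\<Union>F\<in>G. realization (Pow F))"
proof -
  have "\<Gamma> \<union> G = \<Gamma> \<union> (\<Union>F\<in>G. Pow F)"
    using boundary by auto
  then show ?thesis
    by (metis realization_Un realization_UN)
qed

lemma cell_boundary:
  assumes "F \<in> G"
  shows "{x \<in> realization (Pow F). {v. x v \<noteq> 0} \<noteq> F} = realization (Pow F) \<inter> C"
proof -
  have "{v. x v \<noteq> 0} \<noteq> F \<longleftrightarrow> {v. x v \<noteq> 0} \<in> \<Gamma>" if "{v. x v \<noteq> 0} \<subseteq> F" for x :: "'a \<Rightarrow> real"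
    using that new[OF assms] boundary[OF assms] by blast
  then show ?thesis
    by (auto simp: realization_def)
qed

text \<open>A point of a cell outside \<open>C\<close> has the whole cell as its support, and this
  support does not fit into another cell of the same size.\<close>

lemma cell_Int_cell:
  assumes "F \<in> G" "F' \<in> G" "F \<noteq> F'" "x \<in> realization (Pow F)" "x \<in> realization (Pow F')"
  shows "x \<in> C"
proof -
  have "{v. x v \<noteq> 0} \<noteq> F"
  proof
    assume "{v. x v \<noteq> 0} = F"
    moreover have "{v. x v \<noteq> 0} \<subseteq> F'"
      using assms(5) by (simp add: realization_def)
    ultimately show False
      using assms(1-3) cell by (metis card_subset_eq)
  qed
  then show ?thesis
    using cell_boundary[OF assms(1)] assms(4) by blast
qed

lemma closed_cell: "F \<in> G \<Longrightarrow> closed (realization (Pow F))"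
  using cell(1) by (rule closed_realization_Pow)

lemma closed_C: "closed C"
  using complex by (rule closed_realization)

text \<open>The extensions over the cells all restrict to the same contraction on \<open>C\<close>,
  and cells overlap only there, so they paste over a finite closed cover.\<close>

lemma contraction_extends:
  assumes "contractible C" "C \<noteq> {}"
  obtains H :: "real \<times> ('a \<Rightarrow> real) \<Rightarrow> 'a \<Rightarrow> real" and a where
    "continuous_on ({0..1} \<times> X) H" "H \<in> {0..1} \<times> X \<rightarrow> X" "\<And>x. x \<in> X \<Longrightarrow> H (0, x) = x"
    "\<And>t x. \<lbrakk>0 \<le> t; t \<le> 1; x \<in> C\<rbrakk> \<Longrightarrow> H (t, x) \<in> C" "\<And>x. x \<in> C \<Longrightarrow> H (1, x) = a"
proof -
  obtain h :: "real \<times> ('a \<Rightarrow> real) \<Rightarrow> 'a \<Rightarrow> real" and a where h: "a \<in> C" "continuous_on ({0..1} \<times> C) h" "h \<in> {0..1} \<times> C \<rightarrow> C"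
      "\<And>x. x \<in> C \<Longrightarrow> h (0, x) = x" "\<And>x. x \<in> C \<Longrightarrow> h (1, x) = a"
    using contractible_contraction[OF assms] by blast
  have "\<exists>K. continuous_on ({0..1} \<times> realization (Pow F)) K \<and>
      K \<in> {0..1} \<times> realization (Pow F) \<rightarrow> realization (Pow F) \<union> C \<and>
      (\<forall>x\<in>realization (Pow F). K (0, x) = x) \<and>
      (\<forall>t\<in>{0..1::real}. \<forall>x\<in>realization (Pow F) \<inter> C. K (t, x) = h (t, x))" if "F \<in> G" for F
  proof -
    have "F \<noteq> {}" using cell(2)[OF that] by auto
    then show ?thesis
      using radial_homotopy[OF cell(1)[OF that] _ cell_boundary[OF that] h(2-4)] by blast
  qed
  then have "\<forall>F\<in>G. \<exists>K. continuous_on ({0..1} \<times> realization (Pow F)) K \<and>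
      K \<in> {0..1} \<times> realization (Pow F) \<rightarrow> realization (Pow F) \<union> C \<and>
      (\<forall>x\<in>realization (Pow F). K (0, x) = x) \<and>
      (\<forall>t\<in>{0..1::real}. \<forall>x\<in>realization (Pow F) \<inter> C. K (t, x) = h (t, x))"
    by blast
  from bchoice[OF this] obtain K where K: "\<And>F. F \<in> G \<Longrightarrow> continuous_on ({0..1} \<times> realization (Pow F)) (K F)"
      "\<And>F. F \<in> G \<Longrightarrow> K F \<in> {0..1} \<times> realization (Pow F) \<rightarrow> realization (Pow F) \<union> C"
      "\<And>F x. \<lbrakk>F \<in> G; x \<in> realization (Pow F)\<rbrakk> \<Longrightarrow> K F (0, x) = x"
      "\<And>F t x. \<lbrakk>F \<in> G; t \<in> {0..1::real}; x \<in> realization (Pow F) \<inter> C\<rbrakk> \<Longrightarrow> K F (t, x) = h (t, x)"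
    by blast
  \<comment> \<open>\<open>None\<close> stands for the closed set \<open>C\<close>,
    \<open>Some F\<close> for the closed cell on \<open>F\<close>.\<close>
  define S where "S i = {0..1::real} \<times> (case i of None \<Rightarrow> C | Some F \<Rightarrow> realization (Pow F))" for i
  define f where "f i = (case i of None \<Rightarrow> h | Some F \<Rightarrow> K F)" for i
  let ?I = "insert None (Some ` G)"
  obtain H where H: "continuous_map (top_of_set ({0..1} \<times> X)) (top_of_set X) H"
    "\<And>z i. \<lbrakk>i \<in> ?I; z \<in> topspace (top_of_set ({0..1} \<times> X)) \<inter> S i\<rbrakk> \<Longrightarrow> H z = f i z"
  proof (rule pasting_lemma_exists_closed[of ?I "top_of_set ({0..1} \<times> X)" S "top_of_set X" f])
    show "finite ?I" using finite_cells by simp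
    show "topspace (top_of_set ({0..1} \<times> X)) \<subseteq> \<Union>(S ` ?I)"
      by (auto simp: S_def realization_eq)
    fix i assume i: "i \<in> ?I"
    have Si: "S i \<subseteq> {0..1} \<times> X"
      using i by (auto simp: S_def realization_eq)
    show "closedin (top_of_set ({0..1} \<times> X)) (S i)"
      using i closed_C closed_cell Si
      by (intro closed_subset) (auto simp: S_def intro!: closed_Times)
    show "continuous_map (subtopology (top_of_set ({0..1} \<times> X)) (S i)) (top_of_set X) (f i)"
    proof -
      have "continuous_on (S i) (f i)"
        using i h(2) K(1) by (auto simp: S_def f_def)
      moreover have "f i \<in> S i \<rightarrow> X"
        using i h(3) K(2) by (fastforce simp: S_def f_def realization_eq)
      ultimately show ?thesis
        using Si by (simp add: subtopology_subtopology inf.absorb2)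
    qed
    fix j z assume j: "j \<in> ?I" and z: "z \<in> topspace (top_of_set ({0..1} \<times> X)) \<inter> S i \<inter> S j"
    obtain t x where tx: "z = (t, x)" "t \<in> {0..1}" using z by auto
    have eq: "f i z = h z" if "i \<in> ?I" "z \<in> S i" "x \<in> C" for i
      using that K(4) tx by (auto simp: f_def S_def)
    show "f i z = f j z"
    proof (cases "i = j \<or> x \<in> C")
      case True
      then show ?thesis using eq i j z by auto
    next
      case False
      obtain F where F: "i = Some F" "F \<in> G" "x \<in> realization (Pow F)"
        using i z tx False by (auto simp: S_def)
      obtain F' where F': "j = Some F'" "F' \<in> G" "x \<in> realization (Pow F')"
        using j z tx False by (auto simp: S_def)
      have "x \<in> C" using False F F' cell_Int_cell[of F F' x] by blast
      with False show ?thesis by simp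
    qed
  qed (use that in blast)
  have HC: "H (t, x) = h (t, x)" if "0 \<le> t" "t \<le> 1" "x \<in> C" for t x
    using that H(2)[of None "(t, x)"] by (simp add: S_def f_def realization_eq)
  have "H (0, x) = x" if x: "x \<in> X" for x
  proof (cases "x \<in> C")
    case True
    then show ?thesis using HC h(4) by simp
  next
    case False
    then obtain F where F: "F \<in> G" "x \<in> realization (Pow F)"
      using x by (auto simp: realization_eq)
    then show ?thesis
      using H(2)[of "Some F" "(0, x)"] K(3) x by (simp add: S_def f_def)
  qed
  moreover have "H (t, x) \<in> C" if "0 \<le> t" "t \<le> 1" "x \<in> C" for t x
    using HC[OF that] h(3) that by auto
  moreover have "H (1, x) = a" if "x \<in> C" for x
    using HC[of 1 x] h(5) that by simp
  moreover have "continuous_on ({0..1} \<times> X) H" "H \<in> {0..1} \<times> X \<rightarrow> X"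
    using H(1) by auto
  ultimately show thesis using that by blast
qed

text \<open>Each cell is wrapped around its own sphere and \<open>C\<close> goes to the base point.
  Openness in the wedge can be tested on one sphere at a time, where the map from the cell is
  already a quotient map.\<close>

lemma quotient_is_wedge:
  assumes "1 \<le> d" "C \<noteq> {}"
  obtains f where "quotient_map (top_of_set X) (wedge_of_spheres (card G) d) f"
    "\<And>x y. \<lbrakk>x \<in> C; y \<in> C\<rbrakk> \<Longrightarrow> f x = f y"
    "\<And>x y. \<lbrakk>x \<in> X; y \<in> X; f x = f y\<rbrakk> \<Longrightarrow> x = y \<or> x \<in> C \<and> y \<in> C"
proof -
  let ?m = "card G"
  let ?S = "sum_topology (\<lambda>_. nsphere d) {..<?m}"
  let ?W = "wedge_of_spheres ?m d"
  let ?D = "\<lambda>F. realization (Pow F)"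
  let ?w = "wedge_proj (\<lambda>_. sphere_base) :: nat \<times> (nat \<Rightarrow> real) \<Rightarrow> _"
  have W: "?W = wedge_topology (\<lambda>_. nsphere d) (\<lambda>_. sphere_base) {..<?m}"
    by (simp add: wedge_of_spheres_def)
  obtain \<beta> where \<beta>: "bij_betw \<beta> G {..<?m}"
    using ex_bij_betw_finite_nat[OF finite_cells] by (auto simp: atLeast0LessThan)
  have \<beta>_less: "\<beta> F < ?m" if "F \<in> G" for F
    using \<beta> that by (auto simp: bij_betw_def)
  have \<beta>_inj: "\<beta> F = \<beta> F' \<longleftrightarrow> F = F'" if "F \<in> G" "F' \<in> G" for F F'
    using \<beta> that by (auto simp: bij_betw_def inj_on_def)
  have "\<forall>F\<in>G. \<exists>p. quotient_map (top_of_set (?D F)) (nsphere d) p \<and>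
      (\<forall>x\<in>?D F. p x = sphere_base \<longleftrightarrow> {v. x v \<noteq> 0} \<noteq> F) \<and>
      inj_on p {x \<in> ?D F. {v. x v \<noteq> 0} = F}"
    using simplex_modulo_boundary_sphere[OF cell assms(1)] by blast
  from bchoice[OF this] obtain p where p: "\<And>F. F \<in> G \<Longrightarrow> quotient_map (top_of_set (?D F)) (nsphere d) (p F)"
      "\<And>F. F \<in> G \<Longrightarrow> \<forall>x\<in>?D F. p F x = sphere_base \<longleftrightarrow> {v. x v \<noteq> 0} \<noteq> F"
      "\<And>F. F \<in> G \<Longrightarrow> inj_on (p F) {x \<in> ?D F. {v. x v \<noteq> 0} = F}"
    by blast
  have p_base: "p F x = sphere_base \<longleftrightarrow> x \<in> C" if "F \<in> G" "x \<in> ?D F" for F x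
    using p(2)[OF that(1)] cell_boundary[OF that(1)] that(2) by blast
  have p_image: "p F ` ?D F = topspace (nsphere d)" if "F \<in> G" for F
    using quotient_imp_surjective_map[OF p(1)[OF that]] by simp
  define S where "S i = (case i of None \<Rightarrow> C | Some F \<Rightarrow> ?D F)" for i
  define g where "g i = (case i of None \<Rightarrow> (\<lambda>_. None) | Some F \<Rightarrow> (\<lambda>x. ?w (\<beta> F, p F x)))" for i
  let ?I = "insert None (Some ` G)"
  have cont_cell: "continuous_map (top_of_set (?D F)) ?W (\<lambda>x. ?w (\<beta> F, p F x))" if F: "F \<in> G" for F
  proof -
    have "continuous_map (top_of_set (?D F)) (nsphere d) (p F)"
      using p(1)[OF F] by (rule quotient_imp_continuous_map)
    moreover have "continuous_map (nsphere d) ?S (Pair (\<beta> F))"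
      using continuous_map_component_injection[of "\<beta> F" "{..<?m}" "\<lambda>_. nsphere d"] \<beta>_less[OF F] by simp
    moreover have "continuous_map ?S ?W ?w"
      unfolding W using \<beta>_less[OF F] in_topspace_nsphere[of d]
      by (intro quotient_imp_continuous_map quotient_map_wedge_proj) (auto simp: topspace_nsphere sum_atMost_split_0)
    ultimately have "continuous_map (top_of_set (?D F)) ?W (?w \<circ> (Pair (\<beta> F) \<circ> p F))"
      by (meson continuous_map_compose)
    then show ?thesis by (simp add: o_def)
  qed
  obtain f where f: "continuous_map (top_of_set X) ?W f"
    "\<And>x i. \<lbrakk>i \<in> ?I; x \<in> topspace (top_of_set X) \<inter> S i\<rbrakk> \<Longrightarrow> f x = g i x"
  proof (rule pasting_lemma_exists_closed[of ?I "top_of_set X" S ?W g])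
    show "finite ?I" using finite_cells by simp
    show "topspace (top_of_set X) \<subseteq> \<Union>(S ` ?I)"
      by (auto simp: S_def realization_eq)
    fix i assume i: "i \<in> ?I"
    have Si: "S i \<subseteq> X"
      using i by (auto simp: S_def realization_eq)
    show "closedin (top_of_set X) (S i)"
      using i closed_C closed_cell Si by (intro closed_subset) (auto simp: S_def)
    have "continuous_map (top_of_set (S i)) ?W (g i)"
      using i cont_cell by (auto simp: S_def g_def W topspace_wedge_topology)
    then show "continuous_map (subtopology (top_of_set X) (S i)) ?W (g i)"
      using Si by (simp add: subtopology_subtopology inf.absorb2)
    fix j x assume j: "j \<in> ?I" and x: "x \<in> topspace (top_of_set X) \<inter> S i \<inter> S j"
    have eq: "g i x = None" if "i \<in> ?I" "x \<in> S i" "x \<in> C" for i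
      using that p_base by (auto simp: g_def S_def wedge_proj_def)
    show "g i x = g j x"
    proof (cases "i = j \<or> x \<in> C")
      case True
      then show ?thesis using eq i j x by auto
    next
      case False
      obtain F where F: "i = Some F" "F \<in> G" "x \<in> ?D F"
        using i x False by (auto simp: S_def)
      obtain F' where F': "j = Some F'" "F' \<in> G" "x \<in> ?D F'"
        using j x False by (auto simp: S_def)
      have "x \<in> C" using False F F' cell_Int_cell[of F F' x] by blast
      with False show ?thesis by simp
    qed
  qed (use that in blast)
  have fC: "f x = None" if "x \<in> C" for x
    using that f(2)[of None x] by (simp add: S_def g_def realization_eq)
  have fD: "f x = ?w (\<beta> F, p F x)" if "F \<in> G" "x \<in> ?D F" for F x
    using that f(2)[of "Some F" x] by (auto simp: S_def g_def realization_eq)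
  have f_None: "f x = None \<longleftrightarrow> x \<in> C" if "F \<in> G" "x \<in> ?D F" for F x
    using fD[OF that] p_base[OF that] by (simp add: wedge_proj_def)
  have inj: "x = y \<or> x \<in> C \<and> y \<in> C" if xy: "x \<in> X" "y \<in> X" "f x = f y" for x y
  proof (cases "x \<in> C \<or> y \<in> C")
    case True
    then have "f x = None" "f y = None" using fC xy(3) by auto
    then show ?thesis
      using xy f_None unfolding realization_eq by blast
  next
    case False
    then obtain F F' where F: "F \<in> G" "x \<in> ?D F" "F' \<in> G" "y \<in> ?D F'"
      using xy unfolding realization_eq by blast
    have "(\<beta> F, p F x) = (\<beta> F', p F' y)"
      using xy(3) False p_base F by (auto simp: fD wedge_proj_def split: if_splits)
    then have "F' = F" "p F x = p F y"
      using \<beta>_inj F by auto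
    moreover have "{v. x v \<noteq> 0} = F" "{v. y v \<noteq> 0} = F"
      using False F \<open>F' = F\<close> cell_boundary[OF F(1)] by blast+
    ultimately show ?thesis
      using inj_onD[OF p(3)[OF F(1)], of x y] F by auto
  qed
  have surj: "f ` X = topspace ?W"
  proof
    show "f ` X \<subseteq> topspace ?W"
      using continuous_map_image_subset_topspace[OF f(1)] by simp
    \<comment> \<open>The base point is hit through \<open>C\<close>, also when there are no cells
      and the wedge is a single point.\<close>
    have "None \<in> f ` X"
      using assms(2) fC by (force simp: realization_eq)
    moreover have "?w (i, s) \<in> f ` X" if si: "i < ?m" "s \<in> topspace (nsphere d)" for i s
    proof -
      obtain F where F: "F \<in> G" "\<beta> F = i"
        using \<beta> si(1) by (metis bij_betw_iff_bijections lessThan_iff)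
      have "s \<in> p F ` ?D F"
        using p_image[OF F(1)] si(2) by simp
      then obtain x where x: "x \<in> ?D F" "p F x = s"
        by blast
      have "f x = ?w (i, s)" using fD[OF F(1) x(1)] F x by simp
      moreover have "x \<in> X" using F x by (auto simp: realization_eq)
      ultimately show ?thesis by (metis image_eqI)
    qed
    ultimately show "topspace ?W \<subseteq> f ` X"
      unfolding W topspace_wedge_topology by auto
  qed
  have "quotient_map (top_of_set X) ?W f"
    unfolding quotient_map_def
  proof (intro conjI allI impI)
    show "f ` topspace (top_of_set X) = topspace ?W" using surj by simp
    fix U assume U: "U \<subseteq> topspace ?W"
    show "openin (top_of_set X) {x \<in> topspace (top_of_set X). f x \<in> U} = openin ?W U"
    proof
      assume "openin ?W U"
      then show "openin (top_of_set X) {x \<in> topspace (top_of_set X). f x \<in> U}"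
        using f(1) by (rule openin_continuous_map_preimage[rotated])
    next
      assume op: "openin (top_of_set X) {x \<in> topspace (top_of_set X). f x \<in> U}"
      \<comment> \<open>The trace of \<open>U\<close> on sphere \<open>i\<close>; its preimage in
        the corresponding cell is the trace of the given open set.\<close>
      define V where "V i = {s \<in> topspace (nsphere d). ?w (i, s) \<in> U}" for i
      have V: "openin (nsphere d) (V i)" if i: "i < ?m" for i
      proof -
        obtain F where F: "F \<in> G" "\<beta> F = i"
          using \<beta> i by (metis bij_betw_iff_bijections lessThan_iff)
        have DX: "?D F \<subseteq> X" using F by (auto simp: realization_eq)
        have "openin (subtopology (top_of_set X) (?D F)) (?D F \<inter> {x \<in> topspace (top_of_set X). f x \<in> U})"
          using op by (rule openin_subtopology_Int2)
        then have "openin (top_of_set (?D F)) (?D F \<inter> {x \<in> X. f x \<in> U})"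
          using DX by (simp add: subtopology_subtopology inf.absorb2)
        also have "?D F \<inter> {x \<in> X. f x \<in> U} = {x \<in> topspace (top_of_set (?D F)). p F x \<in> V i}"
          using DX fD[OF F(1)] F p_image[OF F(1)] by (auto simp: V_def)
        finally have "openin (top_of_set (?D F)) {x \<in> topspace (top_of_set (?D F)). p F x \<in> V i}" .
        moreover have "V i \<subseteq> topspace (nsphere d)" by (auto simp: V_def)
        ultimately show ?thesis
          using p(1)[OF F(1)] unfolding quotient_map_def by simp
      qed
      have "{s. (i, s) \<in> {z \<in> topspace ?S. ?w z \<in> U}} = V i" if "i < ?m" for i
        using that by (simp add: V_def)
      then have "openin ?S {z \<in> topspace ?S. ?w z \<in> U}"
        unfolding openin_sum_topology using V by (simp add: Collect_conj_eq)
      then show "openin ?W U"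
        using U unfolding W openin_wedge_topology topspace_wedge_topology by blast
    qed
  qed
  then show thesis
  proof (rule that)
    show "f x = f y" if "x \<in> C" "y \<in> C" for x y
      using that fC by simp
  qed (rule inj)
qed

lemma homotopy_equivalent_wedge:
  assumes "1 \<le> d" "contractible C" "C \<noteq> {}"
  shows "geometric_realization (\<Gamma> \<union> G) homotopy_equivalent_space wedge_of_spheres (card G) d"
proof -
  obtain H :: "real \<times> ('a \<Rightarrow> real) \<Rightarrow> 'a \<Rightarrow> real" and a where H:
    "continuous_on ({0..1} \<times> X) H" "H \<in> {0..1} \<times> X \<rightarrow> X" "\<And>x. x \<in> X \<Longrightarrow> H (0, x) = x"
    "\<And>t x. \<lbrakk>0 \<le> t; t \<le> 1; x \<in> C\<rbrakk> \<Longrightarrow> H (t, x) \<in> C" "\<And>x. x \<in> C \<Longrightarrow> H (1, x) = a"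
    using contraction_extends[OF assms(2,3)] by metis
  obtain f where f: "quotient_map (top_of_set X) (wedge_of_spheres (card G) d) f"
    "\<And>x y. \<lbrakk>x \<in> C; y \<in> C\<rbrakk> \<Longrightarrow> f x = f y"
    "\<And>x y. \<lbrakk>x \<in> X; y \<in> X; f x = f y\<rbrakk> \<Longrightarrow> x = y \<or> x \<in> C \<and> y \<in> C"
    using quotient_is_wedge[OF assms(1,3)] by metis
  show ?thesis
    unfolding geometric_realization_eq
  proof (rule homotopy_equivalent_collapse[OF f(1), of H C])
    show "continuous_map (prod_topology (top_of_set {0..1}) (top_of_set X)) (top_of_set X) H"
      using H(1,2) by simp
    show "H (0, x) = x" if "x \<in> topspace (top_of_set X)" for x
      using that H(3) by simp
    show "H (1, x) = H (1, y)" if "x \<in> C" "y \<in> C" for x y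
      using that H(5) by simp
    show "x = y \<or> x \<in> C \<and> y \<in> C"
      if "x \<in> topspace (top_of_set X)" "y \<in> topspace (top_of_set X)" "f x = f y" for x y
      using that f(3)[of x y] by simp
  qed (fact H(4) f(2))+
qed

end

section \<open>Splitting a shelling into a contractible part and spheres\<close>

text \<open>\<open>G\<close> consists of the facets that are attached along their whole boundary.\<close>

lemma shelling_decomposition:
  assumes fin: "\<And>F. F \<in> set Fs \<Longrightarrow> finite F" and card: "\<And>F. F \<in> set Fs \<Longrightarrow> card F = Suc d"
    and dist: "distinct Fs"
    and shell: "\<And>j H. \<lbrakk>j < length Fs; 0 < j; H \<in> facets ((\<Union>i<j. Pow (Fs ! i)) \<inter> Pow (Fs ! j))\<rbrakk>
      \<Longrightarrow> Suc (card H) = card (Fs ! j)"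
    and "0 < j" "j \<le> length Fs"
  shows "\<exists>\<Gamma> G. (\<Union>i<j. Pow (Fs ! i)) = \<Gamma> \<union> G \<and> facet_attachment \<Gamma> G d \<and> G \<subseteq> set Fs \<and>
    contractible (realization \<Gamma>) \<and> realization \<Gamma> \<noteq> {}"
  using assms(5,6)
proof (induction j rule: nat_induct_non_zero)
  case 1
  let ?F = "Fs ! 0"
  have "?F \<in> set Fs" using 1 by (intro nth_mem) linarith
  then have F: "finite ?F" "card ?F = Suc d" using fin card by auto
  then obtain v where v: "v \<in> ?F" by fastforce
  then have "(\<lambda>w. if w = v then 1 else 0) \<in> realization (Pow ?F)"
    using F by (auto simp: realization_Pow)
  moreover have "contractible (realization (Pow ?F))"
    using F v by (intro contractible_realization_Pow) auto
  moreover have "facet_attachment (Pow ?F) {} d"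
    using F by unfold_locales (auto simp: finite_complex_Pow)
  ultimately show ?case
    by (intro exI[of _ "Pow ?F"] exI[of _ "{}"]) auto
next
  case (Suc j)
  then obtain \<Gamma> G where IH: "(\<Union>i<j. Pow (Fs ! i)) = \<Gamma> \<union> G" "facet_attachment \<Gamma> G d" "G \<subseteq> set Fs"
      "contractible (realization \<Gamma>)" "realization \<Gamma> \<noteq> {}"
    by auto
  interpret facet_attachment \<Gamma> G d by (rule IH(2))
  define Y where "Y = (\<Union>i<j. Pow (Fs ! i))"
  have Y: "Y = \<Gamma> \<union> G" using IH(1) by (simp add: Y_def)
  let ?F = "Fs ! j"
  have j: "j < length Fs" "0 < j" using Suc by auto
  have F: "finite ?F" "card ?F = Suc d" using fin card j by auto
  \<comment> \<open>The restriction of \<open>?F\<close>, known from shelling theory as its least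
    new face. By the shelling condition every old face of \<open>?F\<close> lies in an old facet
    \<open>?F - {v}\<close>, that is, misses some \<open>v\<close> in \<open>R\<close>.\<close>
  define R where "R = {v \<in> ?F. ?F - {v} \<in> Y}"
  have down: "\<tau> \<in> Y" if "\<sigma> \<in> Y" "\<tau> \<subseteq> \<sigma>" for \<sigma> \<tau>
    using that by (auto simp: Y_def)
  have faces: "\<sigma> \<in> Y \<longleftrightarrow> \<not> R \<subseteq> \<sigma>" if \<sigma>: "\<sigma> \<subseteq> ?F" for \<sigma>
  proof
    assume "\<not> R \<subseteq> \<sigma>"
    then obtain v where "v \<in> R" "v \<notin> \<sigma>" by blast
    then show "\<sigma> \<in> Y" using down[of "?F - {v}" \<sigma>] \<sigma> by (auto simp: R_def)
  next
    assume "\<sigma> \<in> Y"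
    have "finite (Y \<inter> Pow ?F)" using F by simp
    moreover have "\<sigma> \<in> Y \<inter> Pow ?F" using \<open>\<sigma> \<in> Y\<close> \<sigma> by simp
    ultimately obtain H where H: "H \<in> Y \<inter> Pow ?F" "\<sigma> \<subseteq> H"
        "\<forall>H'\<in>Y \<inter> Pow ?F. H \<subseteq> H' \<longrightarrow> H = H'"
      using finite_has_maximal2[of "Y \<inter> Pow ?F" \<sigma>] by auto
    then have "H \<in> facets (Y \<inter> Pow ?F)"
      unfolding facets_def by blast
    then have cH: "Suc (card H) = card ?F" unfolding Y_def by (rule shell[OF j])
    have "H \<subseteq> ?F" using H by blast
    then have "card (?F - H) = 1"
      using cH F by (simp add: card_Diff_subset finite_subset)
    then obtain v where v: "?F - H = {v}" by (auto simp: card_1_singleton_iff)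
    then have "H = ?F - {v}" "v \<in> ?F" using \<open>H \<subseteq> ?F\<close> by auto
    then have "v \<in> R" "v \<notin> \<sigma>" using H by (auto simp: R_def)
    then show "\<not> R \<subseteq> \<sigma>" by blast
  qed
  have RF: "R \<subseteq> ?F" by (auto simp: R_def)
  \<comment> \<open>An earlier simplex exists and contributes the empty face, so at least one facet
    of \<open>?F\<close> is old.\<close>
  have "{} \<in> Y" using j by (auto simp: Y_def)
  then have R_ne: "R \<noteq> {}" using faces[of "{}"] by auto
  have FX: "?F \<notin> Y" using faces[of ?F] RF by blast
  \<comment> \<open>A discarded cell inside \<open>?F\<close> would equal it by size, but
    \<open>?F\<close> is new. So \<open>?F\<close> meets the old complex only in
    \<open>\<Gamma>\<close>, which can grow regardless of \<open>G\<close>.\<close>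
  have G_face: "\<sigma> \<notin> G" if "\<sigma> \<subseteq> ?F" for \<sigma>
  proof
    assume "\<sigma> \<in> G"
    then have "\<sigma> = ?F" using that F cell(2) by (metis card_subset_eq)
    then show False using FX \<open>\<sigma> \<in> G\<close> Y by blast
  qed
  have \<Gamma>_faces: "\<sigma> \<in> \<Gamma> \<longleftrightarrow> \<not> R \<subseteq> \<sigma>" if "\<sigma> \<subseteq> ?F" for \<sigma>
    using faces[OF that] G_face[OF that] Y by blast
  have X': "(\<Union>i<Suc j. Pow (Fs ! i)) = \<Gamma> \<union> G \<union> Pow ?F"
    using IH(1) by (simp add: lessThan_Suc Un_commute)
  show ?case
  proof (cases "R = ?F")
    case True
    have proper: "\<sigma> \<in> \<Gamma>" if "\<sigma> \<subset> ?F" for \<sigma>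
      using \<Gamma>_faces[of \<sigma>] that True by blast
    then have "\<Gamma> \<union> G \<union> Pow ?F = \<Gamma> \<union> insert ?F G" by auto
    moreover have "?F \<notin> \<Gamma>" using FX Y by blast
    then have "facet_attachment \<Gamma> (insert ?F G) d"
    proof unfold_locales
      show "\<sigma> \<in> \<Gamma>" if "F \<in> insert ?F G" "\<sigma> \<subset> F" for F \<sigma>
        using that proper boundary by blast
    qed (use complex finite_cells cell new F in auto)
    ultimately show ?thesis
      unfolding X' using IH j by (intro exI[of _ \<Gamma>] exI[of _ "insert ?F G"]) auto
  next
    case False
    have "facet_attachment (\<Gamma> \<union> Pow ?F) G d"
    proof
      show "finite_complex (\<Gamma> \<union> Pow ?F)"
        using complex F by (intro finite_complex_Un finite_complex_Pow)
      show "F' \<notin> \<Gamma> \<union> Pow ?F" if "F' \<in> G" for F'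
        using new[OF that] G_face[of F'] that by blast
    qed (use finite_cells cell boundary in auto)
    moreover have "contractible (realization (\<Gamma> \<union> Pow ?F))"
      using complex F RF R_ne False \<Gamma>_faces IH(4) by (intro contractible_realization_Un_Pow) auto
    moreover have "realization (\<Gamma> \<union> Pow ?F) \<noteq> {}"
      using IH(5) by (simp add: realization_Un)
    ultimately show ?thesis
      unfolding X' using IH(3) by (intro exI[of _ "\<Gamma> \<union> Pow ?F"] exI[of _ G]) auto
  qed
qed

theorem shellable_homotopy_equivalent_wedge:
  assumes "finite_complex \<Delta>" "\<Delta> \<noteq> {}" "shellable \<Delta>" "1 \<le> d"
    and card: "\<And>F. F \<in> facets \<Delta> \<Longrightarrow> card F = Suc d"
  shows "\<exists>m. geometric_realization \<Delta> homotopy_equivalent_space wedge_of_spheres m d"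
proof -
  obtain Fs where Fs: "distinct Fs" "set Fs = facets \<Delta>"
      "\<And>j H. \<lbrakk>j < length Fs; 0 < j; H \<in> facets ((\<Union>i<j. Pow (Fs ! i)) \<inter> Pow (Fs ! j))\<rbrakk>
        \<Longrightarrow> Suc (card H) = card (Fs ! j)"
    using assms(3) unfolding shellable_def by blast
  have in_facet: "\<exists>F\<in>facets \<Delta>. \<sigma> \<subseteq> F" if "\<sigma> \<in> \<Delta>" for \<sigma>
    using finite_has_maximal2[OF finite_complexD(1)[OF assms(1)] that] unfolding facets_def by blast
  have "\<Delta> = (\<Union>F\<in>facets \<Delta>. Pow F)"
    using in_facet finite_complexD(3)[OF assms(1)] by (fastforce simp: facets_def)
  also have "\<dots> = (\<Union>i<length Fs. Pow (Fs ! i))"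
  proof -
    have "set Fs = (\<lambda>i. Fs ! i) ` {..<length Fs}"
      by (auto simp: set_conv_nth)
    then show ?thesis
      unfolding Fs(2)[symmetric] by simp
  qed
  finally have \<Delta>: "\<Delta> = (\<Union>i<length Fs. Pow (Fs ! i))" .
  have "0 < length Fs"
    using assms(2) in_facet Fs(2) by fastforce
  moreover have "finite F" if "F \<in> set Fs" for F
    using that Fs(2) finite_complexD(2)[OF assms(1)] by (auto simp: facets_def)
  ultimately obtain \<Gamma> G where \<Gamma>: "\<Delta> = \<Gamma> \<union> G" "facet_attachment \<Gamma> G d"
      "contractible (realization \<Gamma>)" "realization \<Gamma> \<noteq> {}"
    using shelling_decomposition[of Fs d "length Fs"] Fs card \<Delta> by auto
  then show ?thesis
    using facet_attachment.homotopy_equivalent_wedge[OF \<Gamma>(2) assms(4)] by blast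
qed


theorem theorem4p4:
  fixes k n :: nat
  assumes "k \<ge> 2" and "n \<ge> k + 3"
  shows "shellable (cut_complex k (with_proj (squared_path n))) \<and>
    (\<exists>m. geometric_realization (cut_complex k (with_proj (squared_path n)))
           homotopy_equivalent_space wedge_of_spheres m (n - k - 1))"
proof
  let ?G = "with_proj (squared_path n)"
  let ?\<Delta> = "cut_complex k ?G"
  show shell: "shellable ?\<Delta>"
    using assms by (intro shellable_cut_complex_squared_path) auto
  show "\<exists>m. geometric_realization ?\<Delta> homotopy_equivalent_space wedge_of_spheres m (n - k - 1)"
  proof (rule shellable_homotopy_equivalent_wedge[OF _ _ shell])
    have "\<Union>?\<Delta> \<subseteq> {1..n}"
      by (auto simp: cut_complex_def cut_facets_def squared_path_def)
    then show "finite_complex ?\<Delta>"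
      unfolding finite_complex_def by (auto simp: cut_complex_def intro: finite_subset)
    show "?\<Delta> \<noteq> {}"
      using assms by (intro cut_complex_squared_path_nonempty) auto
    fix F assume "F \<in> facets ?\<Delta>"
    then have "card F + k = n"
      using facets_cut_complex[of ?G k] by (simp add: squared_path_def cut_facets_def)
    \<comment> \<open>The truncated difference is exact because \<open>k < n\<close>.\<close>
    then show "card F = Suc (n - k - 1)"
      using assms by simp
  qed (use assms in auto)
qed

end
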